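(* Let $k$ be a field of characteristic zero and $R=k[x_1,x_2,x_3,x_4]$. Let $\mathcal Q\subset\mathbb P^3$ be a smooth quadric surface, let $X\subset\mathcal Q$ be an $a\times b$ grid with $a\le b$, and let $\ell_1,\dots,\ell_{ab}$ be the linear forms dual to the points of $X$. Let $1\le d\le a-1$ and let $I=(\ell_1^d,\dots,\ell_{ab}^d)$. Then $R/I$ has the Weak Lefschetz Property.
   Context: $R$ has the standard grading; $[M]_t$ denotes the degree $t$ component of a graded module $M$. An $a\times b$ grid on a smooth quadric surface $\mathcal Q\subset\mathbb P^3$ is the set of $ab$ intersection points of $a$ distinct lines in one ruling of $\mathcal Q$ with $b$ distinct lines in the other ruling. The linear form dual to a point $[\alpha_1:\dots:\alpha_4]$ is $\sum\alpha_i x_i$ (up to scalar). An artinian graded $k$-algebra $A=R/I$ has the Weak Lefschetz Property if for a general linear form $\ell$ the multiplication map $\times\ell:[A]_{t-1}\to[A]_t$ is injective or surjective for all $t$. *)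

theory Defs
  imports
    "HOL-Analysis.Cartesian_Space"
    "HOL-Library.Numeral_Type"
    "HOL-Library.Poly_Mapping"
    "HOL-Algebra.QuotRing"
    "HOL-Algebra.Algebraic_Closure_Type"
begin

section \<open>Polynomials in finitely many variables\<close>

text \<open>
  A monomial is its exponent function on the finite type of variables, and the ring structure on
  polynomials is the convolution product of \<^theory>\<open>HOL-Library.Poly_Mapping\<close>.
  The ring of the main statement is \<open>('k, 4) mpoly\<close>: the four
  elements of the numeral type \<open>4\<close> index the variables.
\<close>

type_synonym ('k, 'n) mpoly = "('n \<Rightarrow>\<^sub>0 nat) \<Rightarrow>\<^sub>0 'k"

definition homogeneous_part :: "nat \<Rightarrow> ('k::field, 'n::finite) mpoly set"
  where "homogeneous_part t =
    {f. \<forall>m \<in> Poly_Mapping.keys f. (\<Sum>i\<in>UNIV. Poly_Mapping.lookup m i) = t}"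

definition eval_mpoly :: "('k::field, 'n::finite) mpoly \<Rightarrow> 'k ^ 'n \<Rightarrow> 'k"
  where "eval_mpoly f v =
    (\<Sum>m \<in> Poly_Mapping.keys f.
      Poly_Mapping.lookup f m * (\<Prod>i\<in>UNIV. (v $ i) ^ Poly_Mapping.lookup m i))"

text \<open>
  If \<open>x\<^sub>i\<close> does not occur in \<open>m\<close>, the exponent subtraction truncates, but the coefficient is \<open>0\<close>.
\<close>

definition pderiv_mpoly :: "'n::finite \<Rightarrow> ('k::field, 'n) mpoly \<Rightarrow> ('k, 'n) mpoly"
  where "pderiv_mpoly i f =
    (\<Sum>m \<in> Poly_Mapping.keys f.
      Poly_Mapping.single (m - Poly_Mapping.single i 1)
        (of_nat (Poly_Mapping.lookup m i) * Poly_Mapping.lookup f m))"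

definition linear_form :: "'k::field ^ 'n::finite \<Rightarrow> ('k, 'n) mpoly"
  where "linear_form v =
    (\<Sum>i\<in>UNIV. Poly_Mapping.single (Poly_Mapping.single i 1) (v $ i))"

abbreviation mpoly_ring :: "('k::field, 'n::finite) mpoly ring"
  where "mpoly_ring \<equiv> ring_of_type_algebra"


section \<open>The Weak Lefschetz Property\<close>

definition artinian :: "('a, 'b) ring_scheme \<Rightarrow> bool"
  where "artinian A \<longleftrightarrow>
    (\<forall>J :: nat \<Rightarrow> 'a set.
      (\<forall>n. ideal (J n) A \<and> J (Suc n) \<subseteq> J n) \<longrightarrow> (\<exists>N. \<forall>n\<ge>N. J n = J N))"

definition homogeneous_ideal :: "('k::field, 'n::finite) mpoly set \<Rightarrow> bool"
  where "homogeneous_ideal I \<longleftrightarrow>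
    (\<exists>S \<subseteq> (\<Union>t. homogeneous_part t). I = Idl\<^bsub>mpoly_ring\<^esub> S)"

text \<open>The image of \<open>[R]\<^sub>t\<close> in \<open>R/I\<close>, which is \<open>[R/I]\<^sub>t\<close> when \<open>I\<close> is homogeneous.\<close>

definition quotient_part ::
    "('k::field, 'n::finite) mpoly set \<Rightarrow> nat \<Rightarrow> ('k, 'n) mpoly set set"
  where "quotient_part I t = (\<lambda>f. I +>\<^bsub>mpoly_ring\<^esub> f) ` homogeneous_part t"

definition quotient_mult ::
    "('k::field, 'n::finite) mpoly set \<Rightarrow> ('k, 'n) mpoly \<Rightarrow> ('k, 'n) mpoly set \<Rightarrow> ('k, 'n) mpoly set"
  where "quotient_mult I l C =
    (I +>\<^bsub>mpoly_ring\<^esub> l) \<otimes>\<^bsub>mpoly_ring Quot I\<^esub> C"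

definition zariski_open :: "('k::field ^ 'n::finite) set \<Rightarrow> bool"
  where "zariski_open U \<longleftrightarrow> (\<exists>S. U = {v. \<exists>f\<in>S. eval_mpoly f v \<noteq> 0})"

text \<open>
  The Weak Lefschetz Property of the standard graded algebra \<open>R/I\<close>. ``General'' refers to the
  affine space of linear forms, parametrised by their coefficient vectors; one open set serves all
  degrees. The maps are \<open>[A]\<^sub>t \<rightarrow> [A]\<^sub>t\<^sub>+\<^sub>1\<close> for \<open>t \<ge> 0\<close>, because in lower degrees the source is
  zero and the map is injective.
\<close>

definition weak_lefschetz :: "('k::field, 'n::finite) mpoly set \<Rightarrow> bool"
  where "weak_lefschetz I \<longleftrightarrow>
    homogeneous_ideal I \<and> artinian (mpoly_ring Quot I) \<and>
    (\<exists>U. zariski_open U \<and> U \<noteq> {} \<and>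
      (\<forall>v\<in>U. \<forall>t.
        inj_on (quotient_mult I (linear_form v)) (quotient_part I t) \<or>
        quotient_mult I (linear_form v) ` quotient_part I t = quotient_part I (Suc t)))"


section \<open>Grids on smooth quadric surfaces\<close>

text \<open>
  Points and lines of \<open>P\<^sup>3\<close> over \<open>k\<close> are the linear subspaces of \<open>k\<^sup>4\<close> of dimension 1 and 2, and
  incidence is inclusion.
\<close>

definition proj_point :: "('k::field ^ 4) set \<Rightarrow> bool"
  where "proj_point P \<longleftrightarrow> vec.subspace P \<and> vec.dim P = 1"

definition proj_line :: "('k::field ^ 4) set \<Rightarrow> bool"
  where "proj_line L \<longleftrightarrow> vec.subspace L \<and> vec.dim L = 2"

definition lies_on :: "('k::field ^ 4) set \<Rightarrow> ('k, 4) mpoly \<Rightarrow> bool"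
  where "lies_on L q \<longleftrightarrow> (\<forall>v\<in>L. eval_mpoly q v = 0)"

text \<open>Smoothness is the Jacobian criterion at all points over the algebraic closure.\<close>

definition smooth_quadric :: "('k::field, 4) mpoly \<Rightarrow> bool"
  where "smooth_quadric q \<longleftrightarrow>
    q \<in> homogeneous_part 2 \<and>
    (\<forall>v :: 'k alg_closure ^ 4.
      v \<noteq> 0 \<longrightarrow> eval_mpoly (Poly_Mapping.map to_ac q) v = 0 \<longrightarrow>
      (\<exists>i. eval_mpoly (Poly_Mapping.map to_ac (pderiv_mpoly i q)) v \<noteq> 0))"

text \<open>
  A ruling is a family of lines on the surface sweeping it out, with exactly one line through each
  point. If a smooth quadric contains a line over \<open>k\<close>, there are exactly two such families.
\<close>

definition ruling :: "('k::field, 4) mpoly \<Rightarrow> ('k ^ 4) set set \<Rightarrow> bool"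
  where "ruling q F \<longleftrightarrow>
    (\<forall>L\<in>F. proj_line L \<and> lies_on L q) \<and>
    (\<forall>P. proj_point P \<and> lies_on P q \<longrightarrow> (\<exists>!L. L \<in> F \<and> P \<subseteq> L))"

definition grid :: "('k::field, 4) mpoly \<Rightarrow> nat \<Rightarrow> nat \<Rightarrow> ('k ^ 4) set set \<Rightarrow> bool"
  where "grid q a b Z \<longleftrightarrow>
    (\<exists>F G A B. ruling q F \<and> ruling q G \<and> F \<noteq> G \<and>
      A \<subseteq> F \<and> finite A \<and> card A = a \<and> B \<subseteq> G \<and> finite B \<and> card B = b \<and>
      Z = {P. proj_point P \<and> (\<exists>L\<in>A. \<exists>M\<in>B. P \<subseteq> L \<and> P \<subseteq> M)})"

definition dual_form :: "('k::field ^ 4) set \<Rightarrow> ('k, 4) mpoly \<Rightarrow> bool"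
  where "dual_form P l \<longleftrightarrow> (\<exists>v\<in>P. v \<noteq> 0 \<and> l = linear_form v)"

end

theory Submission
  imports Defs
begin

text \<open>
  On the quadric, identified with \<open>P\<^sup>1 \<times> P\<^sup>1\<close> by points \<open>s \<otimes> t\<close>, the power
  \<open>\<ell>\<^sup>d\<close> is of degree \<open>d\<close> in \<open>s\<close> and in \<open>t\<close>; as both sides of the grid have more than \<open>d\<close> points,
  interpolation puts \<open>\<ell>\<^sub>w\<^sup>d\<close> into \<open>I\<close> for every point \<open>w\<close> of the quadric.
  Modulo a linear form \<open>\<ell>\<^sub>v\<close> one may differentiate this along the quadric: if \<open>v\<close> is not
  in the tangent space at \<open>w\<close>, the tangent space and \<open>v\<close> span \<open>k\<^sup>4\<close>, so that
  \<open>\<ell>\<^sub>w\<^sup>d\<^sup>-\<^sup>k R\<^sub>k\<close> lies in \<open>I + \<ell>\<^sub>v R\<close> for all such \<open>w\<close>, by induction on \<open>k\<close>. For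
  \<open>k = d\<close> this is surjectivity of \<open>\<times>\<ell>\<^sub>v\<close> onto all degrees \<open>\<ge> d\<close>; into degrees \<open>< d\<close>,
  where \<open>I\<close> vanishes, multiplication is injective because \<open>R\<close> is a domain.
\<close>

section \<open>Interpolation in spaces of polynomials\<close>

abbreviation const_mpoly :: "'k::field \<Rightarrow> ('k, 'n::finite) mpoly"
  where "const_mpoly c \<equiv> Poly_Mapping.single 0 c"

text \<open>Scalars act through constant polynomials, so that ideals are subspaces over
  \<open>'k\<close> and spans and bases are available.\<close>

interpretation mpoly: vector_space "\<lambda>c (f :: ('k::field, 'n::finite) mpoly). const_mpoly c * f"
  by unfold_locales (simp_all add: algebra_simps single_add mult_single flip: mult.assoc)

lemma const_mpoly_power: "const_mpoly c ^ n = const_mpoly (c ^ n)"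
  by (induction n) (simp_all add: mult_single)

text \<open>Interpolation by difference quotients: for a fixed node \<open>x\<close>, the quotient
  of \<open>p\<close> by \<open>X - x\<close> takes at the other nodes the values
  \<open>(p(y) - p(x)) / (y - x)\<close>, which are in \<open>J\<close>, and its degree is one less.
  An infinite \<open>E\<close> puts no bound on the degree.\<close>

lemma coeff_in_subspace:
  fixes p :: "('k::field, 'n::finite) mpoly poly"
  assumes J: "mpoly.subspace J"
    and "\<And>x. x \<in> E \<Longrightarrow> poly p (const_mpoly x) \<in> J"
    and "finite E \<Longrightarrow> Polynomial.degree p < card E"
    and "E \<noteq> {}"
  shows "Polynomial.coeff p i \<in> J"
  using assms(2-4)
proof (induction "Polynomial.degree p" arbitrary: p E i)
  case 0
  then obtain a where "p = [:a:]"
    by (metis degree_eq_zeroE)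
  moreover obtain x where "x \<in> E"
    using \<open>E \<noteq> {}\<close> by blast
  ultimately show ?case
    using "0.prems"(1)[of x] mpoly.subspace_0[OF J] by (cases i) auto
next
  case (Suc n)
  obtain x where x: "x \<in> E"
    using \<open>E \<noteq> {}\<close> by blast
  define r where "r = synthetic_div p (const_mpoly x)"
  \<comment> \<open>This is \<open>p = p(x) + (X - x) r\<close>, with multiplication by
    \<open>X\<close> written as \<open>pCons\<close>.\<close>
  have p: "p = pCons (poly p (const_mpoly x)) r - Polynomial.smult (const_mpoly x) r"
    using synthetic_div_correct[of p "const_mpoly x"] by (simp add: r_def eq_diff_eq)
  have r_in: "poly r (const_mpoly y) \<in> J" if "y \<in> E - {x}" for y
  proof -
    have "poly p (const_mpoly y)
        = poly p (const_mpoly x) + const_mpoly y * poly r (const_mpoly y) - const_mpoly x * poly r (const_mpoly y)"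
      by (subst p) simp
    then have "const_mpoly (y - x) * poly r (const_mpoly y) = poly p (const_mpoly y) - poly p (const_mpoly x)"
      by (simp add: single_diff algebra_simps)
    then have "const_mpoly (y - x) * poly r (const_mpoly y) \<in> J"
      using mpoly.subspace_diff[OF J Suc.prems(1) Suc.prems(1)] x that by simp
    from mpoly.subspace_scale[OF J this, of "inverse (y - x)"] that show ?thesis
      by (simp add: mult_single flip: mult.assoc)
  qed
  have deg: "n = Polynomial.degree r"
    using Suc.hyps(2) by (simp add: r_def degree_synthetic_div)
  have deg_less: "Polynomial.degree r < card (E - {x})" if "finite (E - {x})"
    using Suc.prems(2) Suc.hyps(2) that x deg by (simp add: card_Diff_singleton)
  have "E - {x} \<noteq> {}"
    using deg_less by (metis card.empty finite.emptyI not_less0)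
  from Suc.hyps(1)[OF deg r_in deg_less this]
  have "Polynomial.coeff r j \<in> J" for j by blast
  then show ?case
    by (subst p) (auto simp: coeff_pCons x split: nat.split
        intro!: mpoly.subspace_diff[OF J] mpoly.subspace_scale[OF J] Suc.prems(1) mpoly.subspace_0[OF J]
          mpoly.subspace_neg[OF J])
qed

text \<open>The power is a binary form of degree \<open>d\<close> in the two scalars, hence
  determined by its values at more than \<open>d\<close> points of the projective line. The
  conditions on \<open>E\<close> say that its pairs are homogeneous coordinates of distinct
  points.\<close>

lemma power_in_subspace:
  fixes P Q :: "('k::field_char_0, 'n::finite) mpoly"
  assumes J: "mpoly.subspace J"
    and d: "d < card E"
    and E0: "(0, 0) \<notin> E"
    and E: "\<And>\<alpha> \<beta> \<alpha>' \<beta>'. (\<alpha>, \<beta>) \<in> E \<Longrightarrow> (\<alpha>', \<beta>') \<in> E \<Longrightarrow> \<alpha> * \<beta>' = \<alpha>' * \<beta> \<Longrightarrow> (\<alpha>, \<beta>) = (\<alpha>', \<beta>')"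
    and "\<And>\<alpha> \<beta>. (\<alpha>, \<beta>) \<in> E \<Longrightarrow> (const_mpoly \<alpha> * P + const_mpoly \<beta> * Q) ^ d \<in> J"
  shows "(const_mpoly a * P + const_mpoly b * Q) ^ d \<in> J"
proof (cases "(a, b) = (0, 0)")
  case True
  show ?thesis
  \<comment> \<open>For \<open>d = 0\<close> the zero pair gives the power \<open>1\<close>, not
    \<open>0\<close>; any member of \<open>E\<close> shows that \<open>1\<close> is in
    \<open>J\<close>.\<close>
  proof (cases "d = 0")
    case True
    with d obtain e where "e \<in> E" by (metis card_gt_0_iff ex_in_conv)
    with assms(5)[of "fst e" "snd e"] True show ?thesis by simp
  qed (use True mpoly.subspace_0[OF J] in \<open>simp add: zero_power\<close>)
next
  case False
  have fin: "finite E"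
    using d card.infinite by fastforce
  then have "finite ((\<lambda>(\<alpha>, \<beta>). - \<alpha> / \<beta>) ` insert (a, b) E)"
    by simp
  \<comment> \<open>move the point at infinity away from the given points\<close>
  then obtain c where c: "c \<notin> (\<lambda>(\<alpha>, \<beta>). - \<alpha> / \<beta>) ` insert (a, b) E"
    using ex_new_if_finite infinite_UNIV_char_0 by blast
  have ne: "\<alpha> + c * \<beta> \<noteq> 0" if "(\<alpha>, \<beta>) \<in> insert (a, b) E" for \<alpha> \<beta>
  proof
    assume 0: "\<alpha> + c * \<beta> = 0"
    with that False E0 have "\<beta> \<noteq> 0" by auto
    with 0 have "c = - \<alpha> / \<beta>"
      by (simp add: field_simps eq_neg_iff_add_eq_0)
    with c that show False by force
  qed
  \<comment> \<open>\<open>\<alpha> P + \<beta> Q = (\<alpha> + c \<beta>) P + \<beta> Z\<close>,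
    and by \<open>ne\<close> the first coefficient does not vanish; so \<open>r\<close> is an affine
    coordinate and \<open>p\<close> the dehomogenised form.\<close>
  define Z where "Z = Q - const_mpoly c * P"
  define p where "p = [:P, Z:] ^ d"
  define r where "r = (\<lambda>(\<alpha>, \<beta>). \<beta> / (\<alpha> + c * \<beta>))"
  have eq: "(const_mpoly \<alpha> * P + const_mpoly \<beta> * Q) ^ d
      = const_mpoly ((\<alpha> + c * \<beta>) ^ d) * poly p (const_mpoly (r (\<alpha>, \<beta>)))"
    if "(\<alpha>, \<beta>) \<in> insert (a, b) E" for \<alpha> \<beta>
  proof -
    have "const_mpoly \<alpha> * P + const_mpoly \<beta> * Q
        = const_mpoly (\<alpha> + c * \<beta>) * P + const_mpoly \<beta> * Z"
      by (simp add: Z_def algebra_simps single_add mult_single flip: mult.assoc)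
    also have "\<dots> = const_mpoly (\<alpha> + c * \<beta>) * (P + const_mpoly (r (\<alpha>, \<beta>)) * Z)"
      using ne[OF that] by (simp add: r_def distrib_left mult_single flip: mult.assoc)
    finally show ?thesis
      by (simp add: p_def power_mult_distrib const_mpoly_power)
  qed
  have "inj_on r E"
  proof (rule inj_onI, clarify)
    fix \<alpha> \<beta> \<alpha>' \<beta>' assume h: "(\<alpha>, \<beta>) \<in> E" "(\<alpha>', \<beta>') \<in> E" "r (\<alpha>, \<beta>) = r (\<alpha>', \<beta>')"
    then have "\<alpha> * \<beta>' = \<alpha>' * \<beta>"
      using ne[of \<alpha> \<beta>] ne[of \<alpha>' \<beta>'] by (simp add: r_def frac_eq_eq algebra_simps)
    with E[OF h(1,2)] show "\<alpha> = \<alpha>' \<and> \<beta> = \<beta>'" by simp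
  qed
  then have "Polynomial.degree p < card (r ` E)"
    using degree_power_le[of "[:P, Z:]" d] d by (auto simp: card_image p_def split: if_splits)
  moreover have "poly p (const_mpoly x) \<in> J" if x: "x \<in> r ` E" for x
  proof -
    from x obtain \<alpha> \<beta> where h: "(\<alpha>, \<beta>) \<in> E" "x = r (\<alpha>, \<beta>)" by auto
    have "const_mpoly (inverse ((\<alpha> + c * \<beta>) ^ d)) * (const_mpoly \<alpha> * P + const_mpoly \<beta> * Q) ^ d \<in> J"
      by (intro mpoly.subspace_scale[OF J] assms(5) h)
    then show ?thesis
      using h ne[of \<alpha> \<beta>] by (simp add: eq mult_single flip: mult.assoc)
  qed
  moreover have "r ` E \<noteq> {}"
    using d by fastforce
  ultimately have "Polynomial.coeff p i \<in> J" for i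
    using coeff_in_subspace[OF J, of "r ` E" p i] by blast
  then have "poly p (const_mpoly x) \<in> J" for x
    unfolding poly_altdef const_mpoly_power
    by (auto simp: mult.commute[of _ "const_mpoly _"] intro!: mpoly.subspace_sum[OF J] mpoly.subspace_scale[OF J])
  then show ?thesis
    using eq[of a b] mpoly.subspace_scale[OF J] by simp
qed

section \<open>Homogeneous polynomials and Artinian quotients\<close>

lemma ideal_ring_of_type_algebra_iff:
  fixes I :: "'a::comm_ring_1 set"
  shows "ideal I ring_of_type_algebra \<longleftrightarrow>
    0 \<in> I \<and> (\<forall>x\<in>I. \<forall>y\<in>I. x + y \<in> I) \<and> (\<forall>x\<in>I. \<forall>r. r * x \<in> I)"
    (is "_ \<longleftrightarrow> ?R")
proof
  assume "ideal I ring_of_type_algebra"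
  then interpret I: ideal I "ring_of_type_algebra :: 'a ring" .
  show ?R
    using subgroup.one_closed[OF I.a_subgroup] subgroup.m_closed[OF I.a_subgroup] I.I_l_closed
    by (simp add: ring_of_type_algebra_def)
next
  assume R: ?R
  have neg: "- x \<in> I" if "x \<in> I" for x
    using R that by (metis mult_minus1)
  interpret R: cring "ring_of_type_algebra :: 'a ring"
    by (rule cring_from_type_algebra)
  have "\<ominus>\<^bsub>ring_of_type_algebra\<^esub> x = - x" for x :: 'a
    by (rule R.minus_equality) (simp_all add: ring_of_type_algebra_def)
  then have "inv\<^bsub>add_monoid ring_of_type_algebra\<^esub> x = - x" for x :: 'a
    by (simp add: a_inv_def)
  with R neg show "ideal I ring_of_type_algebra"
    by (intro idealI R.ring_axioms subgroup.intro)
      (simp_all add: ring_of_type_algebra_def mult.commute)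
qed

lemma quotient_coset_eq_iff:
  fixes I :: "'a::comm_ring_1 set"
  assumes "ideal I ring_of_type_algebra"
  shows "I +>\<^bsub>ring_of_type_algebra\<^esub> f = I +>\<^bsub>ring_of_type_algebra\<^esub> g \<longleftrightarrow> f - g \<in> I"
proof -
  interpret R: cring "ring_of_type_algebra :: 'a ring"
    by (rule cring_from_type_algebra)
  have "\<ominus>\<^bsub>ring_of_type_algebra\<^esub> x = - x" for x :: 'a
    by (rule R.minus_equality) (simp_all add: ring_of_type_algebra_def)
  then have "f \<ominus>\<^bsub>ring_of_type_algebra\<^esub> g = f - g"
    by (simp add: a_minus_def) (simp add: ring_of_type_algebra_def)
  then show ?thesis
    using R.quotient_eq_iff_same_a_r_cos[OF assms, of f g]
    by (simp add: ring_of_type_algebra_def)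
qed

lemma ideal_imp_subspace: "ideal I mpoly_ring \<Longrightarrow> mpoly.subspace I"
  by (rule mpoly.subspaceI) (auto simp: ideal_ring_of_type_algebra_iff)

section \<open>Graded parts, linear forms and descending chains\<close>

lemma subspace_homogeneous_part: "mpoly.subspace (homogeneous_part t)"
proof (rule mpoly.subspaceI)
  fix f g :: "('k::field, 'n::finite) mpoly" and c :: 'k
  assume f: "f \<in> homogeneous_part t"
  then show "const_mpoly c * f \<in> homogeneous_part t"
    using keys_mult[of "const_mpoly c" f] by (fastforce simp: homogeneous_part_def split: if_splits)
  assume "g \<in> homogeneous_part t"
  with f show "f + g \<in> homogeneous_part t"
    using Poly_Mapping.keys_add[of f g] by (auto simp: homogeneous_part_def)
qed (simp add: homogeneous_part_def)

lemma mult_in_homogeneous_part: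
  "f \<in> homogeneous_part s \<Longrightarrow> g \<in> homogeneous_part t \<Longrightarrow> f * g \<in> homogeneous_part (s + t)"
  using keys_mult[of f g] by (fastforce simp: homogeneous_part_def lookup_add sum.distrib)

lemma one_in_homogeneous_part: "1 \<in> homogeneous_part 0"
  by (simp add: homogeneous_part_def)

lemma power_in_homogeneous_part:
  "f \<in> homogeneous_part s \<Longrightarrow> f ^ n \<in> homogeneous_part (n * s)"
  by (induction n) (auto simp: one_in_homogeneous_part intro: mult_in_homogeneous_part)

lemma linear_form_in_homogeneous_part: "linear_form v \<in> homogeneous_part 1"
  unfolding linear_form_def
  by (intro mpoly.subspace_sum[OF subspace_homogeneous_part])
    (simp add: homogeneous_part_def lookup_single when_def)

lemma prod_list_in_homogeneous_part:
  "set us \<subseteq> homogeneous_part 1 \<Longrightarrow> prod_list us \<in> homogeneous_part (length us)"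
proof (induction us)
  case (Cons u us)
  then show ?case
    using mult_in_homogeneous_part[of u 1 "prod_list us" "length us"] by simp
qed (simp add: one_in_homogeneous_part)

lemma linear_form_add: "linear_form (u + v) = linear_form u + linear_form v"
  by (simp add: linear_form_def single_add sum.distrib)

lemma linear_form_scale: "linear_form (c *s v) = const_mpoly c * linear_form v"
  by (simp add: linear_form_def sum_distrib_left mult_single)

lemma linear_form_axis:
  "linear_form (axis i 1 :: 'k::field ^ 'n::finite) = Poly_Mapping.single (Poly_Mapping.single i 1) 1"
proof -
  have "linear_form (axis i 1 :: 'k ^ 'n)
      = (\<Sum>j\<in>UNIV. if j = i then Poly_Mapping.single (Poly_Mapping.single j 1) 1 else 0)"
    unfolding linear_form_def by (intro sum.cong) (auto simp: axis_def)
  then show ?thesis by simp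
qed

lemma lookup_linear_form:
  fixes v :: "'k::field ^ 'n::finite"
  shows "Poly_Mapping.lookup (linear_form v) (Poly_Mapping.single i 1) = v $ i"
proof -
  have "Poly_Mapping.single j (1 :: nat) = Poly_Mapping.single i 1 \<longleftrightarrow> j = i" for j
    by (metis lookup_single_eq lookup_single_not_eq zero_neq_one)
  then show ?thesis
    by (simp add: linear_form_def lookup_sum lookup_single when_def)
qed

lemma linear_form_eq_0_iff: "linear_form v = 0 \<longleftrightarrow> v = 0"
proof
  assume "linear_form v = 0"
  then show "v = 0"
    using lookup_linear_form[of v] by (simp add: vec_eq_iff)
qed (simp add: linear_form_def)

lemma mpoly_eq_sum_monomials:
  "f = (\<Sum>m\<in>Poly_Mapping.keys f. const_mpoly (Poly_Mapping.lookup f m) * Poly_Mapping.single m 1)"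
  by (rule poly_mapping_eqI)
    (simp add: mult_single lookup_sum lookup_single when_def in_keys_iff)

text \<open>One variable of positive exponent is taken out at a time. The form fits
  \<open>prod_linear_forms_mem\<close>, whose induction exchanges one power of a fixed form for one
  arbitrary linear factor.\<close>

lemma monomial_eq_prod_linear_forms:
  fixes m :: "'n::finite \<Rightarrow>\<^sub>0 nat"
  shows "\<exists>us. length us = (\<Sum>i\<in>UNIV. Poly_Mapping.lookup m i) \<and> set us \<subseteq> range linear_form \<and>
    (Poly_Mapping.single m 1 :: ('k::field, 'n) mpoly) = prod_list us"
proof (induction "\<Sum>i\<in>UNIV. Poly_Mapping.lookup m i" arbitrary: m)
  case 0
  then have "m = 0"
    by (intro poly_mapping_eqI) simp
  then show ?case by simp
next
  case (Suc t)
  then obtain i where i: "Poly_Mapping.lookup m i > 0"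
    by (metis gr0I sum.neutral nat.distinct(1))
  define m' where "m' = m - Poly_Mapping.single i 1"
  have m: "m = Poly_Mapping.single i 1 + m'"
    using i by (intro poly_mapping_eqI) (auto simp: m'_def lookup_add lookup_minus lookup_single when_def)
  have deg: "(\<Sum>j\<in>UNIV. Poly_Mapping.lookup m j) = Suc (\<Sum>j\<in>UNIV. Poly_Mapping.lookup m' j)"
    by (subst m) (simp add: lookup_add sum.distrib lookup_single when_def)
  then obtain us where us: "length us = t" "set us \<subseteq> range linear_form"
      "(Poly_Mapping.single m' 1 :: ('k, 'n) mpoly) = prod_list us"
    using Suc.hyps(1)[of m'] Suc.hyps(2) by auto
  have "(Poly_Mapping.single m 1 :: ('k, 'n) mpoly) = prod_list (linear_form (axis i 1) # us)"
    by (subst m) (simp add: linear_form_axis mult_single flip: us(3))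
  with us deg Suc.hyps(2) show ?case
    by (intro exI[of _ "linear_form (axis i 1) # us"]) auto
qed

text \<open>From a member of minimal dimension on, the chain is constant: a basis of a later member
  extends to one of \<open>V N\<close>, which by minimality has no more elements.\<close>

lemma (in vector_space) antimono_subspaces_stabilize:
  assumes "finite T" and "\<And>n. subspace (V n)" and "\<And>n. V n \<subseteq> span T" and V: "\<And>m n. m \<le> n \<Longrightarrow> V n \<subseteq> V m"
  shows "\<exists>N. \<forall>n\<ge>N. V n = V N"
proof -
  define N where "N = (ARG_MIN (\<lambda>n. dim (V n)) n. True)"
  have N: "dim (V N) \<le> dim (V n)" for n
    unfolding N_def by (rule arg_min_nat_le) simp
  have "V N \<subseteq> V n" if "n \<ge> N" for n
  proof -
    obtain B where B: "B \<subseteq> V n" "independent B" "V n \<subseteq> span B" "card B = dim (V n)"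
      using basis_exists by blast
    then have "B \<subseteq> V N"
      using V[OF that] by blast
    then obtain C where C: "B \<subseteq> C" "C \<subseteq> V N" "independent C" "V N \<subseteq> span C"
      using maximal_independent_subset_extend B(2) by metis
    have "finite C"
      using independent_span_bound[OF \<open>finite T\<close> C(3)] C(2) assms(3) by blast
    moreover have "card C \<le> card B"
      using N[of n] B(4) C basis_card_eq_dim[of C "V N"] by simp
    ultimately have "B = C"
      using C(1) by (meson card_seteq)
    with C(4) B(1) show ?thesis
      using span_minimal assms(2) by blast
  qed
  with V show ?thesis
    by (meson subset_antisym)
qed

text \<open>Modulo \<open>I\<close> every polynomial is a combination of the finitely many monomials
  outside \<open>I\<close>, so a chain of ideals of the quotient is controlled by a chain of
  subspaces of a finite-dimensional space.\<close>

lemma artinian_quotient_if_finite_monomials: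
  fixes I :: "('k::field, 'n::finite) mpoly set"
  assumes I: "ideal I mpoly_ring"
    and fin: "finite {m. Poly_Mapping.single m 1 \<notin> I}"
  shows "artinian (mpoly_ring Quot I)"
  unfolding artinian_def
proof (intro allI impI)
  fix J :: "nat \<Rightarrow> ('k, 'n) mpoly set set"
  assume J: "\<forall>n. ideal (J n) (mpoly_ring Quot I) \<and> J (Suc n) \<subseteq> J n"
  interpret I: ideal I "mpoly_ring :: ('k, 'n) mpoly ring" by (rule I)
  interpret h: ring_hom_ring "mpoly_ring :: ('k, 'n) mpoly ring" "mpoly_ring Quot I" "(+>\<^bsub>mpoly_ring\<^esub>) I"
    by (rule I.rcos_ring_hom_ring)
  \<comment> \<open>The chain is pulled back to the polynomial ring, where its members are subspaces
    containing \<open>I\<close>.\<close>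
  define K where "K n = {f. I +>\<^bsub>mpoly_ring\<^esub> f \<in> J n}" for n
  have add: "I +>\<^bsub>mpoly_ring\<^esub> (f + g) = (I +>\<^bsub>mpoly_ring\<^esub> f) \<oplus>\<^bsub>mpoly_ring Quot I\<^esub> (I +>\<^bsub>mpoly_ring\<^esub> g)" for f g
    using h.hom_add[of f g] by (simp add: ring_of_type_algebra_def)
  have mult: "I +>\<^bsub>mpoly_ring\<^esub> (f * g) = (I +>\<^bsub>mpoly_ring\<^esub> f) \<otimes>\<^bsub>mpoly_ring Quot I\<^esub> (I +>\<^bsub>mpoly_ring\<^esub> g)" for f g
    using h.hom_mult[of f g] by (simp add: ring_of_type_algebra_def)
  have carr: "I +>\<^bsub>mpoly_ring\<^esub> f \<in> carrier (mpoly_ring Quot I)" for f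
    using h.hom_closed[of f] by (simp add: ring_of_type_algebra_def)
  have K_sub: "mpoly.subspace (K n)" for n
  proof -
    interpret Jn: ideal "J n" "mpoly_ring Quot I" using J by simp
    have "I +>\<^bsub>mpoly_ring\<^esub> 0 \<in> J n"
      using Jn.zero_closed h.hom_zero by (simp add: ring_of_type_algebra_def)
    then show ?thesis
      by (intro mpoly.subspaceI) (auto simp: K_def add mult carr intro: Jn.a_closed Jn.I_l_closed)
  qed
  have I_sub_K: "I \<subseteq> K n" for n
  proof
    fix f assume "f \<in> I"
    then have "I +>\<^bsub>mpoly_ring\<^esub> f = I +>\<^bsub>mpoly_ring\<^esub> 0"
      by (simp add: quotient_coset_eq_iff[OF I])
    then show "f \<in> K n"
      using mpoly.subspace_0[OF K_sub[of n]] by (simp add: K_def)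
  qed
  have J_eq: "J n = (+>\<^bsub>mpoly_ring\<^esub>) I ` K n" for n
  proof -
    interpret Jn: ideal "J n" "mpoly_ring Quot I" using J by simp
    have "carrier (mpoly_ring Quot I) = range ((+>\<^bsub>mpoly_ring\<^esub>) I)"
      by (auto simp: FactRing_def A_RCOSETS_def' ring_of_type_algebra_def)
    with Jn.a_subset show ?thesis by (auto simp: K_def)
  qed
  define T where "T = (\<lambda>m. Poly_Mapping.single m 1 :: ('k, 'n) mpoly) ` {m. Poly_Mapping.single m (1 :: 'k) \<notin> I}"
  \<comment> \<open>By \<open>split\<close> below, \<open>K n = I + V n\<close>, so the chain is
    constant as soon as its traces on \<open>span T\<close> are.\<close>
  define V where "V n = K n \<inter> mpoly.span T" for n
  have "K (Suc n) \<subseteq> K n" for n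
    using J unfolding K_def by blast
  then have K_anti: "K n \<subseteq> K m" if "m \<le> n" for m n
    using lift_Suc_antimono_le[of K] that by blast
  then have "V n \<subseteq> V m" if "m \<le> n" for m n
    using that by (auto simp: V_def)
  moreover have "mpoly.subspace (V n)" "V n \<subseteq> mpoly.span T" for n
    by (auto simp: V_def intro: mpoly.subspace_inter K_sub mpoly.subspace_span)
  moreover have "finite T"
    using fin by (simp add: T_def)
  ultimately obtain N where N: "V n = V N" if "n \<ge> N" for n
    using mpoly.antimono_subspaces_stabilize[of T V] by blast
  have split: "\<exists>g. g \<in> mpoly.span T \<and> f - g \<in> I" for f :: "('k, 'n) mpoly"
  proof -
    define c where "c m = const_mpoly (Poly_Mapping.lookup f m) * Poly_Mapping.single m 1" for m
    define A where "A = {m. Poly_Mapping.single m (1 :: 'k) \<in> I}"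
    have "f = (\<Sum>m\<in>Poly_Mapping.keys f. c m)"
      unfolding c_def by (rule mpoly_eq_sum_monomials)
    also have "\<dots> = (\<Sum>m\<in>Poly_Mapping.keys f \<inter> A. c m) + (\<Sum>m\<in>Poly_Mapping.keys f - A. c m)"
      by (subst sum.Int_Diff[where B = A]) auto
    finally have "f - (\<Sum>m\<in>Poly_Mapping.keys f - A. c m) = (\<Sum>m\<in>Poly_Mapping.keys f \<inter> A. c m)"
      by (simp add: diff_eq_eq)
    moreover have "(\<Sum>m\<in>Poly_Mapping.keys f \<inter> A. c m) \<in> I"
      unfolding c_def A_def using ideal_imp_subspace[OF I]
      by (intro mpoly.subspace_sum mpoly.subspace_scale) auto
    moreover have "(\<Sum>m\<in>Poly_Mapping.keys f - A. c m) \<in> mpoly.span T"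
      unfolding c_def A_def T_def
      by (intro mpoly.span_sum mpoly.span_scale mpoly.span_base) auto
    ultimately show ?thesis by metis
  qed
  have "K N \<subseteq> K n" if "n \<ge> N" for n
  proof
    fix f assume f: "f \<in> K N"
    obtain g where g: "g \<in> mpoly.span T" "f - g \<in> I" using split by blast
    with f have "f - (f - g) \<in> K N"
      using mpoly.subspace_diff[OF K_sub] I_sub_K by blast
    with g N[OF that] have "g \<in> K n" by (auto simp: V_def)
    with g have "g + (f - g) \<in> K n"
      using mpoly.subspace_add[OF K_sub] I_sub_K by blast
    then show "f \<in> K n" by simp
  qed
  with K_anti have "\<forall>n\<ge>N. K n = K N"
    by (meson subset_antisym)
  then show "\<exists>N. \<forall>n\<ge>N. J n = J N"
    by (auto simp: J_eq)
qed

section \<open>Surjectivity of multiplication by a linear form\<close>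

text \<open>In each term of the binomial expansion the exponent of \<open>f\<close> is at least
  \<open>m\<close> or that of \<open>g\<close> is at least \<open>n\<close>.\<close>

lemma power_add_in_ideal:
  assumes I: "ideal I (ring_of_type_algebra :: 'a::comm_ring_1 ring)"
    and "f ^ m \<in> I" and "g ^ n \<in> I"
  shows "(f + g) ^ (m + n) \<in> I"
proof -
  have mult: "r * x \<in> I" if "x \<in> I" for x r
    using I that by (simp add: ideal_ring_of_type_algebra_iff)
  have "of_nat (m + n choose k) * f ^ k * g ^ (m + n - k) \<in> I" for k
  proof (cases "m \<le> k")
    case True
    then have "f ^ k = f ^ (k - m) * f ^ m"
      by (simp flip: power_add)
    then have "of_nat (m + n choose k) * f ^ k * g ^ (m + n - k)
        = (of_nat (m + n choose k) * g ^ (m + n - k) * f ^ (k - m)) * f ^ m"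
      by (simp only: mult_ac)
    then show ?thesis using mult[OF assms(2)] by metis
  next
    case False
    then have "g ^ (m + n - k) = g ^ (m - k) * g ^ n"
      by (simp flip: power_add)
    then have "of_nat (m + n choose k) * f ^ k * g ^ (m + n - k)
        = (of_nat (m + n choose k) * f ^ k * g ^ (m - k)) * g ^ n"
      by (simp only: mult_ac)
    then show ?thesis using mult[OF assms(3)] by metis
  qed
  moreover have "sum h A \<in> I" if "\<And>k. h k \<in> I" for h :: "nat \<Rightarrow> 'a" and A
    using that I
    by (induction A rule: infinite_finite_induct) (auto simp: ideal_ring_of_type_algebra_iff)
  ultimately show ?thesis
    by (simp add: binomial_ring)
qed

text \<open>A monomial outside \<open>I\<close> has its \<open>i\<close>-th exponent below
  \<open>N i\<close> for every \<open>i\<close>, which leaves a finite box of exponent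
  vectors.\<close>

lemma finite_monomials_not_in_ideal:
  fixes I :: "('k::field, 'n::finite) mpoly set"
  assumes I: "ideal I mpoly_ring"
    and "\<And>i. \<exists>n. Poly_Mapping.single (Poly_Mapping.single i 1) 1 ^ n \<in> I"
  shows "finite {m. Poly_Mapping.single m 1 \<notin> I}"
proof -
  obtain N where N: "Poly_Mapping.single (Poly_Mapping.single i 1) 1 ^ N i \<in> I" for i
    using assms(2) by metis
  have pow: "(Poly_Mapping.single (Poly_Mapping.single i 1) 1 :: ('k, 'n) mpoly) ^ n
      = Poly_Mapping.single (Poly_Mapping.single i n) 1" for i n
    by (induction n) (simp_all add: mult_single flip: single_add)
  have "Poly_Mapping.single m 1 \<in> I" if "N i \<le> Poly_Mapping.lookup m i" for m i
  proof -
    have "m = (m - Poly_Mapping.single i (N i)) + Poly_Mapping.single i (N i)"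
      using that by (intro poly_mapping_eqI) (auto simp: lookup_add lookup_minus lookup_single when_def)
    then have "Poly_Mapping.single m 1
        = Poly_Mapping.single (m - Poly_Mapping.single i (N i)) (1 :: 'k) * Poly_Mapping.single (Poly_Mapping.single i (N i)) 1"
      by (metis mult_single mult_1)
    then show ?thesis
      using N[of i] I unfolding pow ideal_ring_of_type_algebra_iff by metis
  qed
  then have "{m. Poly_Mapping.single m 1 \<notin> I} \<subseteq> Poly_Mapping.lookup -` (PiE UNIV (\<lambda>i. {..<N i}))"
    by (force simp: not_le[symmetric])
  moreover have "finite (Poly_Mapping.lookup -` (PiE UNIV (\<lambda>i. {..<N i})))"
    by (intro finite_vimageI finite_PiE injI) (auto intro: poly_mapping_eqI)
  ultimately show ?thesis
    by (rule finite_subset)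
qed

text \<open>The coefficient of \<epsilon> in \<open>(A + \<epsilon> B)^(n+1) g\<close> is
  \<open>(n+1) A^n B g\<close>; interpolation at infinitely many \<epsilon> isolates it, and
  characteristic zero removes the factor \<open>n+1\<close>.\<close>

lemma derivative_in_subspace:
  fixes A B g :: "('k::field_char_0, 'n::finite) mpoly"
  assumes J: "mpoly.subspace J"
    and E: "infinite E"
    and "\<And>\<epsilon>. \<epsilon> \<in> E \<Longrightarrow> (A + const_mpoly \<epsilon> * B) ^ Suc n * g \<in> J"
  shows "A ^ n * B * g \<in> J"
proof -
  define p where "p = Polynomial.smult g ([:A, B:] ^ Suc n)"
  have "poly p (const_mpoly \<epsilon>) \<in> J" if "\<epsilon> \<in> E" for \<epsilon>
    using assms(3)[OF that] by (simp add: p_def mult.commute del: power_Suc)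
  then have "Polynomial.coeff p 1 \<in> J"
    using coeff_in_subspace[OF J, of E p 1] E by auto
  moreover have "Polynomial.coeff ([:A, B:] ^ m) 0 = A ^ m" for m
    by (induction m) simp_all
  then have "Polynomial.coeff ([:A, B:] ^ Suc m) 1 = of_nat (Suc m) * (A ^ m * B)" for m
    by (induction m) (simp_all add: algebra_simps)
  then have "Polynomial.coeff p 1 = const_mpoly (of_nat (Suc n)) * (A ^ n * B * g)"
    by (simp add: p_def mult_ac del: power_Suc of_nat_Suc)
  ultimately have "const_mpoly (inverse (of_nat (Suc n))) * (const_mpoly (of_nat (Suc n)) * (A ^ n * B * g)) \<in> J"
    using mpoly.subspace_scale[OF J] by metis
  then show ?thesis
    by (simp add: mult_single del: of_nat_Suc single_of_nat flip: mult.assoc)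
qed

text \<open>The vectors in \<open>pow\<close> form an affine chart of the quadric around
  \<open>e1\<close>. The exchange of powers for arbitrary linear factors runs over all chart points
  whose tangent space misses \<open>v\<close>, and is read off at \<open>e1\<close> itself, where
  this condition is \<open>v22 \<noteq> 0\<close>.\<close>

lemma prod_linear_forms_mem:
  fixes e1 e2 f1 f2 v :: "'k::field_char_0 ^ 'n::finite"
  assumes I: "ideal I mpoly_ring"
    and span: "\<And>u. \<exists>x y z t. u = x *s e1 + y *s e2 + z *s f1 + t *s f2"
    and pow: "\<And>a c. linear_form (e1 + c *s e2 + a *s f1 + (a * c) *s f2) ^ d \<in> I"
    and v: "v = v11 *s e1 + v12 *s e2 + v21 *s f1 + v22 *s f2" "v22 \<noteq> 0"
    and us: "length us = d" "set us \<subseteq> range linear_form"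
  shows "\<exists>h\<in>homogeneous_part (d - 1). prod_list us - linear_form v * h \<in> I"
proof -
  \<comment> \<open>\<open>J\<close> stands for \<open>I + linear_form v * [R]_(d-1)\<close>; the
    degree of the cofactor is kept because surjectivity is needed degree by degree.\<close>
  define J where "J = {f. \<exists>h\<in>homogeneous_part (d - 1). f - linear_form v * h \<in> I}"
  define w where "w a c = e1 + c *s e2 + a *s f1 + (a * c) *s f2" for a c
  \<comment> \<open>\<open>\<beta> a c\<close> is the polar form of the quadric at \<open>w a c\<close> and \<open>v\<close>\<close>
  define \<beta> where "\<beta> a c = a * c * v11 - a * v12 - c * v21 + v22" for a c
  note H = subspace_homogeneous_part[where ?'a = 'k and ?'b = 'n]
  note SI = ideal_imp_subspace[OF I]
  have J: "mpoly.subspace J"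
  proof (rule mpoly.subspaceI)
    show "0 \<in> J"
      using mpoly.subspace_0[OF H, of "d - 1"] mpoly.subspace_0[OF SI]
      by (auto simp: J_def intro!: bexI[of _ 0])
  next
    fix f g assume "f \<in> J" "g \<in> J"
    then obtain h h' where "h \<in> homogeneous_part (d - 1)" "f - linear_form v * h \<in> I"
        "h' \<in> homogeneous_part (d - 1)" "g - linear_form v * h' \<in> I"
      by (auto simp: J_def)
    moreover from this have "(f - linear_form v * h) + (g - linear_form v * h') \<in> I"
      using mpoly.subspace_add[OF SI] by blast
    ultimately show "f + g \<in> J"
      unfolding J_def by (auto simp: algebra_simps intro!: bexI[of _ "h + h'"] mpoly.subspace_add[OF H])
  next
    fix c f assume "f \<in> J"
    then obtain h where "h \<in> homogeneous_part (d - 1)" "f - linear_form v * h \<in> I"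
      by (auto simp: J_def)
    moreover from this have "const_mpoly c * (f - linear_form v * h) \<in> I"
      using mpoly.subspace_scale[OF SI] by blast
    ultimately show "const_mpoly c * f \<in> J"
      unfolding J_def
      by (auto simp: algebra_simps intro!: bexI[of _ "const_mpoly c * h"] mpoly.subspace_scale[OF H])
  qed
  \<comment> \<open>At \<open>k = 0\<close> this is \<open>pow\<close>; at \<open>k = d\<close> the
    power is gone. The point stays arbitrary because each step compares the claim at neighbouring
    points.\<close>
  have "linear_form (w a c) ^ (d - k) * prod_list us \<in> J"
    if "k \<le> d" "length us = k" "set us \<subseteq> range linear_form" "\<beta> a c \<noteq> 0" for a c k us
    using that
  proof (induction k arbitrary: a c us)
    case 0
    then show ?case
      using pow[of c a] mpoly.subspace_0[OF H, of "d - 1"]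
      by (auto simp: J_def w_def intro!: bexI[of _ 0])
  next
    case (Suc k)
    then obtain u us' where u: "us = linear_form u # us'" "length us' = k" "set us' \<subseteq> range linear_form"
      by (cases us) auto
    define n where "n = d - Suc k"
    have n: "d - k = Suc n" "d - 1 = n + k"
      using Suc.prems(1) by (auto simp: n_def)
    define g where "g = prod_list us'"
    \<comment> \<open>\<open>D\<close> collects the vectors whose forms may replace one factor
      \<open>linear_form (w a c)\<close>; the step is done once this subspace is everything.\<close>
    define D where "D = {u. linear_form (w a c) ^ n * linear_form u * g \<in> J}"
    have IH: "linear_form (w a' c') ^ Suc n * g \<in> J" if "\<beta> a' c' \<noteq> 0" for a' c'
      using Suc.IH[of us' a' c'] Suc.prems(1) u that by (simp add: g_def n)
    have D: "vec.subspace D"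
    proof (rule vec.subspaceI)
      fix x y and r :: 'k assume x: "x \<in> D"
      then have "const_mpoly r * (linear_form (w a c) ^ n * linear_form x * g) \<in> J"
        by (intro mpoly.subspace_scale[OF J]) (simp add: D_def)
      then show "r *s x \<in> D"
        by (simp add: D_def linear_form_scale mult_ac)
      assume "y \<in> D"
      with x have "linear_form (w a c) ^ n * linear_form x * g + linear_form (w a c) ^ n * linear_form y * g \<in> J"
        by (intro mpoly.subspace_add[OF J]) (simp_all add: D_def)
      then show "x + y \<in> D"
        by (simp add: D_def linear_form_add algebra_simps)
    qed (simp add: D_def linear_form_eq_0_iff[THEN iffD2] mpoly.subspace_0[OF J])
    \<comment> \<open>Along a direction in which the chart contains a line, \<beta> is affine with
      slope \<gamma> and nonzero at \<open>\<epsilon> = 0\<close>, so it vanishes for at most one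
      \<epsilon>. Differentiating \<open>IH\<close> along that line puts the direction into
      \<open>D\<close>.\<close>
    have dir: "u \<in> D" if u: "\<And>\<epsilon>. \<exists>a' c'. w a c + \<epsilon> *s u = w a' c' \<and> \<beta> a' c' = \<beta> a c + \<epsilon> * \<gamma>" for u \<gamma>
    proof -
      have "{\<epsilon>. \<beta> a c + \<epsilon> * \<gamma> = 0} \<subseteq> {- \<beta> a c / \<gamma>}"
        using Suc.prems(4) by (cases "\<gamma> = 0") (auto simp: eq_minus_divide_eq add_eq_0_iff)
      then have "finite {\<epsilon>. \<beta> a c + \<epsilon> * \<gamma> = 0}"
        using finite_subset by blast
      then have "infinite (UNIV - {\<epsilon>. \<beta> a c + \<epsilon> * \<gamma> = 0})"
        using infinite_UNIV_char_0 Diff_infinite_finite by blast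
      moreover have "(linear_form (w a c) + const_mpoly \<epsilon> * linear_form u) ^ Suc n * g \<in> J"
        if "\<epsilon> \<in> UNIV - {\<epsilon>. \<beta> a c + \<epsilon> * \<gamma> = 0}" for \<epsilon>
        using IH u[of \<epsilon>] that by (metis (mono_tags, lifting) DiffD2 linear_form_add linear_form_scale mem_Collect_eq)
      ultimately show ?thesis
        unfolding D_def using derivative_in_subspace[OF J] by blast
    qed
    have wD: "w a c \<in> D"
      using IH[OF Suc.prems(4)] by (simp add: D_def mult_ac)
    \<comment> \<open>This vector and the one in \<open>cD\<close> are the partial derivatives of
      \<open>w\<close> in \<open>a\<close> and \<open>c\<close>, the directions of the two lines of
      the quadric through \<open>w a c\<close>.\<close>
    have aD: "f1 + c *s f2 \<in> D"
    proof (rule dir[where \<gamma> = "c * v11 - v12"])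
      show "\<exists>a' c'. w a c + \<epsilon> *s (f1 + c *s f2) = w a' c' \<and> \<beta> a' c' = \<beta> a c + \<epsilon> * (c * v11 - v12)" for \<epsilon>
        by (rule exI[of _ "a + \<epsilon>"], rule exI[of _ c]) (simp add: w_def \<beta>_def vec_eq_iff algebra_simps)
    qed
    have cD: "e2 + a *s f2 \<in> D"
    proof (rule dir[where \<gamma> = "a * v11 - v21"])
      show "\<exists>a' c'. w a c + \<epsilon> *s (e2 + a *s f2) = w a' c' \<and> \<beta> a' c' = \<beta> a c + \<epsilon> * (a * v11 - v21)" for \<epsilon>
        by (rule exI[of _ a], rule exI[of _ "c + \<epsilon>"]) (simp add: w_def \<beta>_def vec_eq_iff algebra_simps)
    qed
    \<comment> \<open>For \<open>v\<close> the product is a multiple of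
      \<open>linear_form v\<close>, with a cofactor of degree \<open>n + k = d - 1\<close>.\<close>
    have vD: "v \<in> D"
    proof -
      have "g \<in> homogeneous_part k"
        using prod_list_in_homogeneous_part[of us'] u linear_form_in_homogeneous_part by (auto simp: g_def)
      then have "linear_form (w a c) ^ n * g \<in> homogeneous_part (d - 1)"
        using mult_in_homogeneous_part[OF power_in_homogeneous_part[OF linear_form_in_homogeneous_part]]
        unfolding n by (metis mult.right_neutral)
      then show ?thesis
        using mpoly.subspace_0[OF SI]
        by (auto simp: D_def J_def mult_ac intro!: bexI[of _ "linear_form (w a c) ^ n * g"])
    qed
    \<comment> \<open>Multiples of \<open>w a c\<close> and of the two tangent directions cancel the
      coordinates of \<open>v\<close> along \<open>e1\<close>, \<open>f1\<close> and
      \<open>e2\<close>; what remains along \<open>f2\<close> is \<open>\<beta> a c\<close>. From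
      \<open>f2\<close> the other basis vectors follow.\<close>
    have "v - v11 *s w a c - (v21 - a * v11) *s (f1 + c *s f2) - (v12 - c * v11) *s (e2 + a *s f2) \<in> D"
      by (intro vec.subspace_diff[OF D] vec.subspace_scale[OF D] wD aD cD vD)
    also have "v - v11 *s w a c - (v21 - a * v11) *s (f1 + c *s f2) - (v12 - c * v11) *s (e2 + a *s f2) = \<beta> a c *s f2"
      by (simp add: v(1) w_def \<beta>_def vec_eq_iff algebra_simps)
    finally have "inverse (\<beta> a c) *s (\<beta> a c *s f2) \<in> D"
      by (rule vec.subspace_scale[OF D])
    with Suc.prems(4) have f2: "f2 \<in> D"
      by simp
    have f1: "f1 \<in> D"
      using vec.subspace_diff[OF D aD vec.subspace_scale[OF D f2, of c]] by simp
    have e2: "e2 \<in> D"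
      using vec.subspace_diff[OF D cD vec.subspace_scale[OF D f2, of a]] by simp
    have "w a c - (c *s e2 + a *s f1 + (a * c) *s f2) \<in> D"
      by (intro vec.subspace_diff[OF D] vec.subspace_add[OF D] vec.subspace_scale[OF D] wD e2 f1 f2)
    then have e1: "e1 \<in> D"
      by (simp add: w_def add.assoc)
    have "u \<in> D"
      using span[of u] e1 e2 f1 f2
      by (auto intro!: vec.subspace_add[OF D] vec.subspace_scale[OF D])
    then show ?case
      by (simp add: D_def u(1) g_def n_def mult.assoc)
  qed
  from this[of d us 0 0] us v(2) show ?thesis
    by (simp add: \<beta>_def J_def)
qed

text \<open>As \<open>I\<close> starts in degree \<open>d\<close>, multiplication into lower degrees
  is that of \<open>R\<close>, a domain thanks to the monomial order that the
  \<open>linorder\<close> sort provides. Into degrees from \<open>d\<close> on, \<open>gen\<close>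
  is multiplied up from degree \<open>d\<close>.\<close>

lemma weak_lefschetzI:
  fixes S :: "('k::field, 'n::{finite,linorder}) mpoly set"
  defines "I \<equiv> Idl\<^bsub>mpoly_ring\<^esub> S"
  assumes S: "S \<subseteq> homogeneous_part d" and d: "1 \<le> d"
    and nil: "\<And>i. \<exists>n. Poly_Mapping.single (Poly_Mapping.single i 1) 1 ^ n \<in> I"
    and U: "zariski_open U" "U \<noteq> {}" "0 \<notin> U"
    and gen: "\<And>v us. v \<in> U \<Longrightarrow> length us = d \<Longrightarrow> set us \<subseteq> range linear_form \<Longrightarrow>
      \<exists>h\<in>homogeneous_part (d - 1). prod_list us - linear_form v * h \<in> I"
  shows "weak_lefschetz I"
proof -
  interpret R: cring "mpoly_ring :: ('k, 'n) mpoly ring"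
    by (rule cring_from_type_algebra)
  have carr: "carrier (mpoly_ring :: ('k, 'n) mpoly ring) = UNIV"
    by (simp add: ring_of_type_algebra_def)
  have I: "ideal I mpoly_ring"
    unfolding I_def by (rule R.genideal_ideal) (simp add: carr)
  note SI = ideal_imp_subspace[OF I]
  have mult_I: "f * g \<in> I" if "g \<in> I" for f g
    using I that by (simp add: ideal_ring_of_type_algebra_iff)
  have quotient_mult: "quotient_mult I l (I +>\<^bsub>mpoly_ring\<^esub> f) = I +>\<^bsub>mpoly_ring\<^esub> (l * f)" for l f
    using ideal.rcoset_mult_add[OF I, of l f]
    by (simp add: quotient_mult_def FactRing_def carr) (simp add: ring_of_type_algebra_def)
  \<comment> \<open>Polynomials without terms of degree below \<open>d\<close> form an ideal
    \<open>K\<close> containing the generators.\<close>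
  have deg_I: "d \<le> (\<Sum>i\<in>UNIV. Poly_Mapping.lookup m i)" if "f \<in> I" "m \<in> Poly_Mapping.keys f" for f m
  proof -
    define K where "K = {f :: ('k, 'n) mpoly. \<forall>m\<in>Poly_Mapping.keys f. d \<le> (\<Sum>i\<in>UNIV. Poly_Mapping.lookup m i)}"
    have "ideal K mpoly_ring"
      unfolding ideal_ring_of_type_algebra_iff
    proof (intro conjI ballI allI)
      show "f + g \<in> K" if "f \<in> K" "g \<in> K" for f g
        using that Poly_Mapping.keys_add[of f g] by (auto simp: K_def)
      show "g * f \<in> K" if "f \<in> K" for f g
        using that keys_mult[of g f] by (fastforce simp: K_def lookup_add sum.distrib)
    qed (simp add: K_def)
    moreover have "S \<subseteq> K"
      using S by (auto simp: K_def homogeneous_part_def)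
    ultimately have "I \<subseteq> K"
      unfolding I_def by (rule R.genideal_minimal)
    with that show ?thesis by (auto simp: K_def)
  qed
  have inj: "inj_on (quotient_mult I (linear_form v)) (quotient_part I t)" if v: "v \<in> U" and t: "Suc t < d" for v t
  proof (rule inj_onI)
    fix C D assume "C \<in> quotient_part I t" "D \<in> quotient_part I t"
      and eq: "quotient_mult I (linear_form v) C = quotient_mult I (linear_form v) D"
    then obtain f g where fg: "f \<in> homogeneous_part t" "C = I +>\<^bsub>mpoly_ring\<^esub> f"
        "g \<in> homogeneous_part t" "D = I +>\<^bsub>mpoly_ring\<^esub> g"
      by (auto simp: quotient_part_def)
    with eq have "linear_form v * (f - g) \<in> I"
      by (simp add: quotient_mult quotient_coset_eq_iff[OF I] right_diff_distrib)
    moreover have "linear_form v * (f - g) \<in> homogeneous_part (Suc t)"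
      using mult_in_homogeneous_part[OF linear_form_in_homogeneous_part
          mpoly.subspace_diff[OF subspace_homogeneous_part fg(1,3)], of v] by simp
    \<comment> \<open>Any term would have degree \<open>Suc t < d\<close>, but also degree at least
      \<open>d\<close>, as a term of an element of \<open>I\<close>.\<close>
    ultimately have "Poly_Mapping.keys (linear_form v * (f - g)) = {}"
      using deg_I t by (fastforce simp: homogeneous_part_def)
    then have "linear_form v * (f - g) = 0"
      by simp
    moreover have "linear_form v \<noteq> 0"
      using v U(3) by (auto simp: linear_form_eq_0_iff)
    ultimately show "C = D"
      using fg by simp
  qed
  have surj: "quotient_mult I (linear_form v) ` quotient_part I t = quotient_part I (Suc t)"
    if v: "v \<in> U" and t: "d \<le> Suc t" for v t
  proof
    show "quotient_mult I (linear_form v) ` quotient_part I t \<subseteq> quotient_part I (Suc t)"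
      using mult_in_homogeneous_part[OF linear_form_in_homogeneous_part[of v], of _ t]
      by (auto simp: quotient_part_def quotient_mult)
    have monom: "\<exists>h\<in>homogeneous_part t. Poly_Mapping.single m 1 - linear_form v * h \<in> I"
      if m: "(\<Sum>i\<in>UNIV. Poly_Mapping.lookup m i) = Suc t" for m
    proof -
      obtain us where us: "length us = Suc t" "set us \<subseteq> range linear_form"
          "(Poly_Mapping.single m 1 :: ('k, 'n) mpoly) = prod_list us"
        using monomial_eq_prod_linear_forms[of m] m by metis
      \<comment> \<open>The first \<open>d\<close> factors are handled by \<open>gen\<close>; the
        others raise the degree of the cofactor from \<open>d - 1\<close> to
        \<open>t\<close>.\<close>
      define g where "g = prod_list (drop d us)"
      obtain h where h: "h \<in> homogeneous_part (d - 1)" "prod_list (take d us) - linear_form v * h \<in> I"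
        using gen[OF v, of "take d us"] us t set_take_subset[of d us] by auto
      have "g \<in> homogeneous_part (Suc t - d)"
        using prod_list_in_homogeneous_part[of "drop d us"] us set_drop_subset[of d us]
          linear_form_in_homogeneous_part by (auto simp: g_def)
      then have "g * h \<in> homogeneous_part t"
        using mult_in_homogeneous_part[OF _ h(1), of g "Suc t - d"] t d by simp
      moreover have "Poly_Mapping.single m 1 = prod_list (take d us) * g"
        unfolding us(3) g_def by (metis append_take_drop_id prod_list.append)
      then have "Poly_Mapping.single m 1 - linear_form v * (g * h) = g * (prod_list (take d us) - linear_form v * h)"
        by (simp add: algebra_simps)
      ultimately show ?thesis
        using mult_I[OF h(2), of g] by metis
    qed
    show "quotient_part I (Suc t) \<subseteq> quotient_mult I (linear_form v) ` quotient_part I t"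
    proof
      fix C assume "C \<in> quotient_part I (Suc t)"
      then obtain f where f: "f \<in> homogeneous_part (Suc t)" "C = I +>\<^bsub>mpoly_ring\<^esub> f"
        by (auto simp: quotient_part_def)
      then have "\<forall>m\<in>Poly_Mapping.keys f. \<exists>h\<in>homogeneous_part t. Poly_Mapping.single m 1 - linear_form v * h \<in> I"
        using monom by (simp add: homogeneous_part_def)
      then obtain h where h: "h m \<in> homogeneous_part t" "Poly_Mapping.single m 1 - linear_form v * h m \<in> I"
        if "m \<in> Poly_Mapping.keys f" for m
        by metis
      define g where "g = (\<Sum>m\<in>Poly_Mapping.keys f. const_mpoly (Poly_Mapping.lookup f m) * h m)"
      have "(\<Sum>m\<in>Poly_Mapping.keys f. const_mpoly (Poly_Mapping.lookup f m) *
          (Poly_Mapping.single m 1 - linear_form v * h m)) \<in> I"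
        by (intro mpoly.subspace_sum[OF SI] mpoly.subspace_scale[OF SI] h)
      also have "(\<Sum>m\<in>Poly_Mapping.keys f. const_mpoly (Poly_Mapping.lookup f m) *
          (Poly_Mapping.single m 1 - linear_form v * h m)) = f - linear_form v * g"
        by (subst (4) mpoly_eq_sum_monomials)
          (simp add: g_def right_diff_distrib sum_subtractf sum_distrib_left mult.left_commute)
      finally have "C = quotient_mult I (linear_form v) (I +>\<^bsub>mpoly_ring\<^esub> g)"
        by (simp add: f(2) quotient_mult quotient_coset_eq_iff[OF I])
      moreover have "g \<in> homogeneous_part t"
        unfolding g_def
        by (intro mpoly.subspace_sum[OF subspace_homogeneous_part]
            mpoly.subspace_scale[OF subspace_homogeneous_part] h)
      ultimately show "C \<in> quotient_mult I (linear_form v) ` quotient_part I t"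
        by (auto simp: quotient_part_def)
    qed
  qed
  have "homogeneous_ideal I"
    using S by (auto simp: homogeneous_ideal_def I_def)
  moreover have "artinian (mpoly_ring Quot I)"
    by (intro artinian_quotient_if_finite_monomials finite_monomials_not_in_ideal I nil)
  ultimately show ?thesis
    unfolding weak_lefschetz_def using U(1,2) inj surj by (metis not_less)
qed

section \<open>Quadratic forms and Segre coordinates\<close>

lemma eval_mpoly_superset:
  assumes "finite M" "Poly_Mapping.keys f \<subseteq> M"
  shows "eval_mpoly f v
    = (\<Sum>m\<in>M. Poly_Mapping.lookup f m * (\<Prod>i\<in>UNIV. (v $ i) ^ Poly_Mapping.lookup m i))"
  unfolding eval_mpoly_def using assms
  by (intro sum.mono_neutral_left) (auto simp: in_keys_iff)

lemma eval_mpoly_add: "eval_mpoly (f + g) v = eval_mpoly f v + eval_mpoly g v"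
proof -
  let ?M = "Poly_Mapping.keys f \<union> Poly_Mapping.keys g"
  have "eval_mpoly h v
      = (\<Sum>m\<in>?M. Poly_Mapping.lookup h m * (\<Prod>i\<in>UNIV. (v $ i) ^ Poly_Mapping.lookup m i))"
    if "h \<in> {f, g, f + g}" for h
    using that Poly_Mapping.keys_add[of f g] by (intro eval_mpoly_superset) auto
  then show ?thesis
    by (simp add: lookup_add distrib_right sum.distrib)
qed

lemma eval_mpoly_sum_single:
  assumes "finite A"
  shows "eval_mpoly (\<Sum>x\<in>A. Poly_Mapping.single (h x) (c x)) v
    = (\<Sum>x\<in>A. c x * (\<Prod>i\<in>UNIV. (v $ i) ^ Poly_Mapping.lookup (h x) i))"
  using assms
proof (induction A)
  case empty
  then show ?case by (simp add: eval_mpoly_def)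
next
  case (insert x A)
  have "eval_mpoly (Poly_Mapping.single (h x) (c x)) v
      = c x * (\<Prod>i\<in>UNIV. (v $ i) ^ Poly_Mapping.lookup (h x) i)"
    by (subst eval_mpoly_superset[of "{h x}"]) auto
  with insert show ?case
    by (simp add: eval_mpoly_add)
qed

lemma prod_power_single:
  fixes v :: "'k::field ^ 'n::finite"
  shows "(\<Prod>i\<in>UNIV. (v $ i) ^ Poly_Mapping.lookup (Poly_Mapping.single j n) i) = (v $ j) ^ n"
proof -
  have "(\<Prod>i\<in>UNIV. (v $ i) ^ Poly_Mapping.lookup (Poly_Mapping.single j n) i)
      = (\<Prod>i\<in>UNIV. if i = j then (v $ j) ^ n else 1)"
    by (intro prod.cong) (auto simp: lookup_single when_def)
  then show ?thesis by simp
qed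

lemma eval_mpoly_linear_form: "eval_mpoly (linear_form w) v = (\<Sum>i\<in>UNIV. w $ i * v $ i)"
  unfolding linear_form_def by (subst eval_mpoly_sum_single) (simp_all add: prod_power_single)

lemma eval_mpoly_map_to_ac:
  "eval_mpoly (Poly_Mapping.map to_ac f) (\<chi> i. to_ac (v $ i)) = to_ac (eval_mpoly f v)"
proof -
  have lookup: "Poly_Mapping.lookup (Poly_Mapping.map to_ac f) m = to_ac (Poly_Mapping.lookup f m)" for m
    by (simp add: Poly_Mapping.map.rep_eq when_def)
  then have "Poly_Mapping.keys (Poly_Mapping.map to_ac f) = Poly_Mapping.keys f"
    by (auto simp: in_keys_iff)
  with lookup show ?thesis
    by (simp add: eval_mpoly_def to_ac_sum to_ac_prod)
qed

section \<open>Quadratic forms, polar forms and smoothness\<close>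

lemma degree_2_monomial:
  fixes m :: "'n::finite \<Rightarrow>\<^sub>0 nat"
  assumes "(\<Sum>i\<in>UNIV. Poly_Mapping.lookup m i) = 2"
  shows "\<exists>j k. m = Poly_Mapping.single j 1 + Poly_Mapping.single k 1"
proof -
  have *: "\<exists>j m'. m = Poly_Mapping.single j 1 + m' \<and> (\<Sum>i\<in>UNIV. Poly_Mapping.lookup m' i) = t"
    if deg: "(\<Sum>i\<in>UNIV. Poly_Mapping.lookup m i) = Suc t" for m :: "'n \<Rightarrow>\<^sub>0 nat" and t
  proof -
    obtain i where i: "Poly_Mapping.lookup m i > 0"
      using deg by (metis gr0I sum.neutral nat.distinct(1))
    define m' where "m' = m - Poly_Mapping.single i 1"
    have m: "m = Poly_Mapping.single i 1 + m'"
      using i by (intro poly_mapping_eqI) (auto simp: m'_def lookup_add lookup_minus lookup_single when_def)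
    have "Suc t = Suc (\<Sum>j\<in>UNIV. Poly_Mapping.lookup m' j)"
      by (subst deg[symmetric], subst m) (simp add: lookup_add sum.distrib lookup_single when_def)
    with m show ?thesis by auto
  qed
  obtain j m' where "m = Poly_Mapping.single j 1 + m'" "(\<Sum>i\<in>UNIV. Poly_Mapping.lookup m' i) = Suc 0"
    using *[of m "Suc 0"] assms by auto
  moreover from this obtain k m'' where "m' = Poly_Mapping.single k 1 + m''" "(\<Sum>i\<in>UNIV. Poly_Mapping.lookup m'' i) = 0"
    using *[of m' 0] by auto
  moreover from this have "m'' = 0"
    by (intro poly_mapping_eqI) simp
  ultimately show ?thesis by auto
qed

text \<open>The bilinear form of a quadratic form without the factor 1/2, so that
  \<open>polar q u u\<close> is twice the value at \<open>u\<close>.\<close>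

definition polar :: "('k::field, 'n::finite) mpoly \<Rightarrow> 'k ^ 'n \<Rightarrow> 'k ^ 'n \<Rightarrow> 'k"
  where "polar q u v = eval_mpoly q (u + v) - eval_mpoly q u - eval_mpoly q v"

lemma polar_commute: "polar q u v = polar q v u"
  by (simp add: polar_def add.commute)

lemma eval_mpoly_eq_polar: "eval_mpoly q (u + v) = eval_mpoly q u + eval_mpoly q v + polar q u v"
  by (simp add: polar_def)

context
  fixes q :: "('k::field, 'n::finite) mpoly"
  assumes q: "q \<in> homogeneous_part 2"
begin

text \<open>With each monomial a product of two coordinates, possibly equal, identities for
  quadratic forms can be checked term by term.\<close>

lemma quadric_monomials:
  "\<exists>j k. (\<forall>m\<in>Poly_Mapping.keys q. m = Poly_Mapping.single (j m) 1 + Poly_Mapping.single (k m) 1) \<and>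
    (\<forall>v. eval_mpoly q v = (\<Sum>m\<in>Poly_Mapping.keys q. Poly_Mapping.lookup q m * (v $ j m * v $ k m)))"
proof -
  have "\<forall>m\<in>Poly_Mapping.keys q. \<exists>j k. m = Poly_Mapping.single j 1 + Poly_Mapping.single k 1"
    using q degree_2_monomial by (auto simp: homogeneous_part_def)
  then obtain j k where jk:
      "m = Poly_Mapping.single (j m) 1 + Poly_Mapping.single (k m) 1" if "m \<in> Poly_Mapping.keys q" for m
    by metis
  have "(\<Prod>i\<in>UNIV. (v $ i) ^ Poly_Mapping.lookup m i) = v $ j m * v $ k m"
    if "m \<in> Poly_Mapping.keys q" for v :: "'k ^ 'n" and m
    by (subst jk[OF that])
      (simp add: lookup_add power_add prod.distrib prod_power_single del: One_nat_def)
  then have "eval_mpoly q v = (\<Sum>m\<in>Poly_Mapping.keys q. Poly_Mapping.lookup q m * (v $ j m * v $ k m))" for v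
    by (simp add: eval_mpoly_def)
  with jk show ?thesis by blast
qed

lemma quadric_scale: "eval_mpoly q (c *s v) = c ^ 2 * eval_mpoly q v"
proof -
  obtain j k where "\<forall>v. eval_mpoly q v = (\<Sum>m\<in>Poly_Mapping.keys q. Poly_Mapping.lookup q m * (v $ j m * v $ k m))"
    using quadric_monomials by blast
  then show ?thesis
    by (simp add: sum_distrib_left power2_eq_square mult_ac)
qed

lemma polar_add: "polar q u (v + w) = polar q u v + polar q u w"
proof -
  obtain j k where "\<forall>v. eval_mpoly q v = (\<Sum>m\<in>Poly_Mapping.keys q. Poly_Mapping.lookup q m * (v $ j m * v $ k m))"
    using quadric_monomials by blast
  then show ?thesis
    by (simp add: polar_def algebra_simps sum.distrib)
qed

lemma polar_scale: "polar q u (c *s v) = c * polar q u v"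
proof -
  obtain j k where "\<forall>v. eval_mpoly q v = (\<Sum>m\<in>Poly_Mapping.keys q. Poly_Mapping.lookup q m * (v $ j m * v $ k m))"
    using quadric_monomials by blast
  then show ?thesis
    by (simp add: polar_def quadric_scale algebra_simps sum.distrib sum_distrib_left power2_eq_square)
qed

lemma polar_eq_sum: "polar q u v = (\<Sum>i\<in>UNIV. polar q u (axis i 1) * v $ i)"
proof -
  have "polar q u (\<Sum>i\<in>A. v $ i *s axis i 1) = (\<Sum>i\<in>A. polar q u (axis i 1) * v $ i)" if "finite A" for A
    using that
  proof (induction A)
    case empty
    show ?case using polar_scale[of u 0 0] by simp
  qed (simp add: polar_add polar_scale mult.commute)
  from this[of UNIV] show ?thesis
    by (simp add: basis_expansion)
qed

text \<open>Links the Jacobian criterion to the polar form: the gradient of \<open>q\<close> at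
  \<open>u\<close> is the coefficient vector of \<open>polar q u\<close>.\<close>

lemma eval_pderiv_quadric: "eval_mpoly (pderiv_mpoly i q) u = polar q u (axis i 1)"
proof -
  obtain j k where jk:
      "\<forall>m\<in>Poly_Mapping.keys q. m = Poly_Mapping.single (j m) 1 + Poly_Mapping.single (k m) 1"
      "\<forall>v. eval_mpoly q v = (\<Sum>m\<in>Poly_Mapping.keys q. Poly_Mapping.lookup q m * (v $ j m * v $ k m))"
    using quadric_monomials by blast
  \<comment> \<open>Product rule for two coordinates; if \<open>j m = k m = i\<close>, both summands
    count and give the factor 2.\<close>
  have "of_nat (Poly_Mapping.lookup m i) * (\<Prod>l\<in>UNIV. (u $ l) ^ Poly_Mapping.lookup (m - Poly_Mapping.single i 1) l)
      = (if j m = i then u $ k m else 0) + (if k m = i then u $ j m else 0)"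
    if "m \<in> Poly_Mapping.keys q" for m
  proof -
    have diff: "Poly_Mapping.single i 1 + x - Poly_Mapping.single i 1 = x"
      and diff': "x + Poly_Mapping.single i 1 - Poly_Mapping.single i 1 = x" for x :: "'n \<Rightarrow>\<^sub>0 nat"
      by simp_all
    have "Poly_Mapping.lookup m i = (if j m = i then 1 else 0) + (if k m = i then 1 else 0)"
      by (subst jk(1)[rule_format, OF that]) (simp add: lookup_add lookup_single when_def)
    moreover have "m - Poly_Mapping.single i 1 = Poly_Mapping.single (k m) 1" if "j m = i"
      by (subst jk(1)[rule_format, OF \<open>m \<in> _\<close>]) (simp add: that diff)
    moreover have "m - Poly_Mapping.single i 1 = Poly_Mapping.single (j m) 1" if "k m = i"
      by (subst jk(1)[rule_format, OF \<open>m \<in> _\<close>]) (simp add: that diff')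
    ultimately show ?thesis
      by (cases "j m = i"; cases "k m = i") (simp_all add: prod_power_single del: One_nat_def)
  qed
  then have "eval_mpoly (pderiv_mpoly i q) u = (\<Sum>m\<in>Poly_Mapping.keys q. Poly_Mapping.lookup q m *
      ((if j m = i then u $ k m else 0) + (if k m = i then u $ j m else 0)))"
    unfolding pderiv_mpoly_def
    by (subst eval_mpoly_sum_single) (auto intro!: sum.cong simp: mult_ac)
  also have "\<dots> = polar q u (axis i 1)"
    unfolding polar_def jk(2)[rule_format] sum_subtractf[symmetric]
    by (intro sum.cong) (auto simp: axis_def algebra_simps)
  finally show ?thesis .
qed

end

text \<open>The Jacobian criterion is applied to the image of \<open>u\<close> over the algebraic
  closure; evaluation commutes with \<open>to_ac\<close>, so the nonvanishing derivative is already
  nonzero over the base field.\<close>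

lemma smooth_quadric_nondegenerate:
  assumes "smooth_quadric q" "u \<noteq> 0" "eval_mpoly q u = 0"
  shows "\<exists>v. polar q u v \<noteq> 0"
proof -
  have "(\<chi> i. to_ac (u $ i)) \<noteq> 0"
    using assms(2) by (simp add: vec_eq_iff)
  with assms obtain i where "eval_mpoly (Poly_Mapping.map to_ac (pderiv_mpoly i q)) (\<chi> i. to_ac (u $ i)) \<noteq> 0"
    unfolding smooth_quadric_def by (metis eval_mpoly_map_to_ac to_ac_0)
  then show ?thesis
    using assms(1) by (auto simp: eval_mpoly_map_to_ac eval_pderiv_quadric smooth_quadric_def)
qed

section \<open>Lines on the quadric and a basis adapted to two skew lines\<close>

lemma proj_line_basis:
  assumes "proj_line L"
  shows "\<exists>u v. L = {x *s u + y *s v | x y. True} \<and> (\<forall>x y. x *s u + y *s v = 0 \<longrightarrow> x = 0 \<and> y = 0)"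
proof -
  obtain B where B: "B \<subseteq> L" "vec.independent B" "L \<subseteq> vec.span B" "card B = 2"
    using vec.basis_exists[of L] assms by (metis proj_line_def)
  then obtain u v where uv: "B = {u, v}" "u \<noteq> v"
    by (auto simp: card_2_iff)
  have "L = vec.span B"
    using B assms vec.span_minimal[of B L] by (auto simp: proj_line_def)
  also have "\<dots> = {x *s u + y *s v | x y. True}"
    unfolding uv vec.span_insert by (auto simp: vec.span_singleton algebra_simps)
  finally have L: "L = {x *s u + y *s v | x y. True}" .
  have "x = 0 \<and> y = 0" if "x *s u + y *s v = 0" for x y
  proof -
    define c where "c w = (if w = u then x else y)" for w
    have "(\<Sum>w\<in>{u, v}. c w *s w) = 0"
      using that uv(2) by (simp add: c_def)
    then have "c w = 0" if "w \<in> {u, v}" for w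
      using vec.independentD[OF B(2), of "{u, v}" c w] that by (simp add: uv)
    then have "c u = 0" "c v = 0" by auto
    then show ?thesis using uv(2) by (simp add: c_def)
  qed
  with L show ?thesis by blast
qed

text \<open>As \<open>q\<close> vanishes on both lines, on \<open>L + M = k^4\<close> it is given by
  the polar pairing of \<open>L\<close> with \<open>M\<close>. Smoothness makes this pairing
  perfect, and a dual basis of \<open>M\<close>, up to sign, turns \<open>q\<close> into a
  determinant.\<close>

lemma segre_basis_exists:
  assumes q: "smooth_quadric q"
    and L: "proj_line L" "lies_on L q" and M: "proj_line M" "lies_on M q" and LM: "L \<inter> M = {0}"
  obtains e1 e2 f1 f2 where "e1 \<in> L" "e2 \<in> L"
    "\<And>u. \<exists>x y z t. u = x *s e1 + y *s e2 + z *s f1 + t *s f2"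
    "\<And>x y z t. eval_mpoly q (x *s e1 + y *s e2 + z *s f1 + t *s f2) = x * t - y * z"
proof -
  have q2: "q \<in> homogeneous_part 2"
    using q by (simp add: smooth_quadric_def)
  note lin = polar_add[OF q2] polar_scale[OF q2]
  have lin': "polar q (u + v) w = polar q u w + polar q v w" "polar q (c *s u) w = c * polar q u w" for u v w c
    using lin by (simp_all add: polar_commute[of q _ w])
  have Q_L: "eval_mpoly q u = 0" if "u \<in> L" for u
    using L(2) that by (simp add: lies_on_def)
  have Q_M: "eval_mpoly q u = 0" if "u \<in> M" for u
    using M(2) that by (simp add: lies_on_def)
  obtain a1 a2 where a: "L = {x *s a1 + y *s a2 | x y. True}" "\<forall>x y. x *s a1 + y *s a2 = 0 \<longrightarrow> x = 0 \<and> y = 0"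
    using proj_line_basis[OF L(1)] by blast
  obtain b1 b2 where b: "M = {x *s b1 + y *s b2 | x y. True}"
    using proj_line_basis[OF M(1)] by blast
  have "vec.dim {x + y |x y. x \<in> L \<and> y \<in> M} + vec.dim (L \<inter> M) = vec.dim L + vec.dim M"
    using L(1) M(1) by (intro vec.dim_sums_Int) (auto simp: proj_line_def)
  then have "vec.dim {x + y |x y. x \<in> L \<and> y \<in> M} = 4"
    using L(1) M(1) by (simp add: LM proj_line_def)
  then have "{x + y |x y. x \<in> L \<and> y \<in> M} = UNIV"
    using L(1) M(1) vec.subspace_sums[of L M]
    by (intro vec.subspace_dim_equal) (auto simp: proj_line_def card_cart_basis)
  then have "\<exists>w z. u = w + z \<and> w \<in> L \<and> z \<in> M" for u
    by blast
  then have span: "\<exists>x y z t. u = x *s a1 + y *s a2 + (z *s b1 + t *s b2)" for u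
    unfolding a(1) b by blast
  define m11 m12 m21 m22 where m: "m11 = polar q a1 b1" "m12 = polar q a1 b2"
      "m21 = polar q a2 b1" "m22 = polar q a2 b2"
  define D where "D = m11 * m22 - m12 * m21"
  \<comment> \<open>A singular pairing matrix gives a nonzero \<open>u\<close> in \<open>L\<close>
    orthogonal to \<open>M\<close>, and to \<open>L\<close> because \<open>q\<close> vanishes there;
    \<open>u\<close> would be a singular point.\<close>
  have "D \<noteq> 0"
  proof
    assume D: "D = 0"
    have "\<exists>x y. (x, y) \<noteq> (0, 0) \<and> x * m11 + y * m21 = 0 \<and> x * m12 + y * m22 = 0"
    proof (cases "m11 = 0 \<and> m21 = 0")
      case True
      show ?thesis
      proof (cases "m12 = 0 \<and> m22 = 0")
        case False
        with True have "(m22, - m12) \<noteq> (0, 0) \<and> m22 * m11 + (- m12) * m21 = 0 \<and> m22 * m12 + (- m12) * m22 = 0"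
          by auto
        then show ?thesis by blast
      qed (use True in \<open>auto intro: exI[of _ 1]\<close>)
    next
      case False
      then have "(m21, - m11) \<noteq> (0, 0) \<and> m21 * m11 + (- m11) * m21 = 0 \<and> m21 * m12 + (- m11) * m22 = 0"
        using D by (auto simp: D_def algebra_simps)
      then show ?thesis by blast
    qed
    then obtain x y where xy: "(x, y) \<noteq> (0, 0)" "x * m11 + y * m21 = 0" "x * m12 + y * m22 = 0"
      by blast
    define u where "u = x *s a1 + y *s a2"
    have "u \<noteq> 0"
      using a(2) xy(1) by (auto simp: u_def)
    have "u \<in> L"
      by (auto simp: a(1) u_def)
    have "polar q u w = 0" if "w \<in> L" for w
    proof -
      have "u + w \<in> L"
        using L(1) \<open>u \<in> L\<close> that by (auto simp: proj_line_def intro: vec.subspace_add)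
      with that \<open>u \<in> L\<close> show ?thesis by (simp add: polar_def Q_L)
    qed
    moreover have "a1 \<in> L" "a2 \<in> L"
      unfolding a(1) by (force intro: exI[of _ 1] exI[of _ 0])+
    moreover have "polar q u b1 = 0" "polar q u b2 = 0"
      using xy(2,3) by (simp_all add: u_def lin' m)
    ultimately have "polar q u v = 0" for v
      using span[of v] by (auto simp: lin)
    then show False
      using smooth_quadric_nondegenerate[OF q \<open>u \<noteq> 0\<close> Q_L[OF \<open>u \<in> L\<close>]] by blast
  qed
  \<comment> \<open>Cramer's rule for the values in \<open>B\<close>: \<open>f2\<close> and
    \<open>- f1\<close> are the basis of \<open>M\<close> dual to \<open>a1\<close> and
    \<open>a2\<close>. The sign is that of \<open>y * z\<close> in the determinant.\<close>
  define f1 where "f1 = (m12 / D) *s b1 + (- m11 / D) *s b2"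
  define f2 where "f2 = (m22 / D) *s b1 + (- m21 / D) *s b2"
  have B: "polar q a1 f1 = 0" "polar q a2 f1 = -1" "polar q a1 f2 = 1" "polar q a2 f2 = 0"
    unfolding f1_def f2_def lin m[symmetric] using \<open>D \<noteq> 0\<close>
    by (simp_all add: divide_simps) (simp_all add: D_def algebra_simps)
  have b_eq: "b1 = m11 *s f2 - m21 *s f1" "b2 = m12 *s f2 - m22 *s f1"
  proof -
    have "m11 *s f2 - m21 *s f1 = ((m11 * m22 - m12 * m21) / D) *s b1"
      "m12 *s f2 - m22 *s f1 = ((m11 * m22 - m12 * m21) / D) *s b2"
      by (simp_all add: f1_def f2_def vec_eq_iff algebra_simps diff_divide_distrib)
    then show "b1 = m11 *s f2 - m21 *s f1" "b2 = m12 *s f2 - m22 *s f1"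
      using \<open>D \<noteq> 0\<close> by (simp_all flip: D_def)
  qed
  show ?thesis
  proof
    show "a1 \<in> L" "a2 \<in> L"
      unfolding a(1) by (force intro: exI[of _ 1] exI[of _ 0])+
    show "\<exists>x y z t. u = x *s a1 + y *s a2 + z *s f1 + t *s f2" for u
    proof -
      obtain x y z t where "u = x *s a1 + y *s a2 + (z *s b1 + t *s b2)"
        using span by blast
      then have "u = x *s a1 + y *s a2 + (- z * m21 - t * m22) *s f1 + (z * m11 + t * m12) *s f2"
        unfolding b_eq by (simp add: vec_eq_iff algebra_simps)
      then show ?thesis by blast
    qed
    show "eval_mpoly q (x *s a1 + y *s a2 + z *s f1 + t *s f2) = x * t - y * z" for x y z t
    proof -
      have "x *s a1 + y *s a2 \<in> L"
        by (auto simp: a(1))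
      moreover have "f1 \<in> M" "f2 \<in> M"
        unfolding b f1_def f2_def by blast+
      then have "z *s f1 + t *s f2 \<in> M"
        using M(1) by (auto simp: proj_line_def intro: vec.subspace_add vec.subspace_scale)
      ultimately have "eval_mpoly q ((x *s a1 + y *s a2) + (z *s f1 + t *s f2)) = x * t - y * z"
        by (simp add: eval_mpoly_eq_polar[of q "_ + _"] Q_L Q_M lin lin' B)
      then show ?thesis by (simp add: add.assoc)
    qed
  qed
qed

section \<open>Rulings in Segre coordinates\<close>

lemma proj_point_span: "u \<noteq> 0 \<Longrightarrow> proj_point (vec.span {u})"
  by (simp add: proj_point_def)

lemma lies_on_span:
  "q \<in> homogeneous_part 2 \<Longrightarrow> eval_mpoly q u = 0 \<Longrightarrow> lies_on (vec.span {u}) q"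
  by (auto simp: lies_on_def vec.span_singleton quadric_scale)

text \<open>A common nonzero vector spans a point of the quadric, through which a ruling has one
  line only. Hence distinct lines of a ruling are skew.\<close>

lemma ruling_unique:
  assumes "smooth_quadric q" "ruling q F" "L \<in> F" "M \<in> F" "u \<in> L" "u \<in> M" "u \<noteq> 0"
  shows "L = M"
proof -
  have "proj_line L" "lies_on L q" "proj_line M"
    using assms by (auto simp: ruling_def)
  then have "vec.span {u} \<subseteq> L" "vec.span {u} \<subseteq> M" "eval_mpoly q u = 0"
    using assms vec.span_minimal[of "{u}"] by (auto simp: proj_line_def lies_on_def)
  moreover from this have "proj_point (vec.span {u})" "lies_on (vec.span {u}) q"
    using assms by (auto simp: smooth_quadric_def intro!: proj_point_span lies_on_span)
  ultimately show ?thesis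
    using assms(2-4) unfolding ruling_def by blast
qed

lemma span_pair: "vec.span {u, v} = {x *s u + y *s v | x y. True}"
  unfolding vec.span_insert by (auto simp: vec.span_singleton algebra_simps)

text \<open>Vectors are read as matrices with rows \<open>(x, y)\<close> and \<open>(z, t)\<close>:
  \<open>q\<close> is the determinant, and the points of the quadric are the matrices of rank
  one.\<close>

locale segre_basis =
  fixes q :: "('k::field_char_0, 4) mpoly" and e1 e2 f1 f2 :: "'k ^ 4"
  assumes span: "\<exists>x y z t. u = x *s e1 + y *s e2 + z *s f1 + t *s f2"
    and eval_q: "eval_mpoly q (x *s e1 + y *s e2 + z *s f1 + t *s f2) = x * t - y * z"
begin

text \<open>The Segre map: the product of the column \<open>(a, b)\<close> and the row
  \<open>(c, d)\<close>.\<close>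

definition segre :: "'k \<Rightarrow> 'k \<Rightarrow> 'k \<Rightarrow> 'k \<Rightarrow> 'k ^ 4"
  where "segre a b c d = (a * c) *s e1 + (a * d) *s e2 + (b * c) *s f1 + (b * d) *s f2"

definition segre_line :: "'k \<Rightarrow> 'k \<Rightarrow> ('k ^ 4) set"
  where "segre_line a b = {segre a b c d | c d. True}"

text \<open>Adding a vanishing combination changes no value of \<open>q\<close>, so the determinant
  would be invariant under translation by the coefficient matrix; comparing values at the zero
  matrix and the four matrix units makes that matrix zero.\<close>

lemma independent:
  assumes "x *s e1 + y *s e2 + z *s f1 + t *s f2 = 0"
  shows "x = 0 \<and> y = 0 \<and> z = 0 \<and> t = 0"
proof -
  have "(x + x') * (t + t') - (y + y') * (z + z') = x' * t' - y' * z'" for x' y' z' t'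
  proof -
    have "(x + x') *s e1 + (y + y') *s e2 + (z + z') *s f1 + (t + t') *s f2
        = (x *s e1 + y *s e2 + z *s f1 + t *s f2) + (x' *s e1 + y' *s e2 + z' *s f1 + t' *s f2)"
      by (simp add: vec.scale_left_distrib)
    then show ?thesis
      unfolding assms by (metis add_0 eval_q)
  qed
  from this[of 0 0 0 0] this[of 1 0 0 0] this[of 0 1 0 0] this[of 0 0 1 0] this[of 0 0 0 1]
  show ?thesis by (auto simp: algebra_simps)
qed

lemma coordinates_eq:
  assumes "x *s e1 + y *s e2 + z *s f1 + t *s f2 = x' *s e1 + y' *s e2 + z' *s f1 + t' *s f2"
  shows "x = x' \<and> y = y' \<and> z = z' \<and> t = t'"
proof -
  have "(x - x') *s e1 + (y - y') *s e2 + (z - z') *s f1 + (t - t') *s f2 = 0"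
    using assms by (simp add: vec.scale_left_diff_distrib algebra_simps)
  from independent[OF this] show ?thesis by simp
qed

lemma segre_eq_iff:
  "segre a b c d = segre a' b' c' d' \<longleftrightarrow>
    a * c = a' * c' \<and> a * d = a' * d' \<and> b * c = b' * c' \<and> b * d = b' * d'"
  using coordinates_eq by (auto simp: segre_def)

lemma segre_eq_0_iff: "segre a b c d = 0 \<longleftrightarrow> a = 0 \<and> b = 0 \<or> c = 0 \<and> d = 0"
proof -
  have "segre 0 0 0 0 = 0"
    by (simp add: segre_def)
  then show ?thesis
    using segre_eq_iff[of a b c d 0 0 0 0] by auto
qed

lemma eval_segre: "eval_mpoly q (segre a b c d) = 0"
  by (simp add: segre_def eval_q)

lemma segre_linear:
  "segre a b (x * c + y * c') (x * d + y * d') = x *s segre a b c d + y *s segre a b c' d'"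
  by (simp add: segre_def vec_eq_iff algebra_simps)

text \<open>In a matrix of determinant zero the first row is zero or the second is a multiple of
  it.\<close>

lemma eval_q_eq_0_imp_segre:
  assumes "eval_mpoly q u = 0"
  shows "\<exists>a b c d. u = segre a b c d"
proof -
  obtain x y z t where u: "u = x *s e1 + y *s e2 + z *s f1 + t *s f2"
    using span by blast
  with assms have det: "x * t = y * z"
    by (simp add: eval_q)
  consider "x \<noteq> 0" | "x = 0" "y \<noteq> 0" | "x = 0" "y = 0"
    by blast
  then show ?thesis
  proof cases
    case 1
    with det have "u = segre 1 (z / x) x y"
      by (simp add: u segre_def field_simps)
    then show ?thesis by blast
  next
    case 2
    with det have "u = segre 1 (t / y) x y"
      by (simp add: u segre_def)
    then show ?thesis by blast
  next
    case 3
    then have "u = segre 0 1 z t"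
      by (simp add: u segre_def)
    then show ?thesis by blast
  qed
qed

lemma proj_line_eq_segre_line:
  assumes L: "proj_line L" and sub: "L \<subseteq> segre_line a b"
  shows "L = segre_line a b"
proof -
  have line: "segre_line a b = vec.span {segre a b 1 0, segre a b 0 1}"
  proof -
    define u v where "u = segre a b 1 0" and "v = segre a b 0 1"
    have "segre a b c d = c *s u + d *s v" for c d
      using segre_linear[of a b c 1 d 0 0 1] by (simp add: u_def v_def)
    then show ?thesis
      by (simp add: segre_line_def span_pair flip: u_def v_def)
  qed
  have "vec.dim (segre_line a b) \<le> card {segre a b 1 0, segre a b 0 1}"
    unfolding line by (metis vec.dim_span vec.dim_le_card' finite.emptyI finite.insertI)
  also have "\<dots> \<le> vec.dim L"
    using L card_insert_le_m1[of 2 "{segre a b 0 1}" "segre a b 1 0"] by (simp add: proj_line_def)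
  finally show ?thesis
    using L sub by (intro vec.subspace_dim_equal) (auto simp: proj_line_def line)
qed

text \<open>The factor between proportional pairs passes to the parameters \<open>c\<close> and
  \<open>d\<close>; the line depends only on a point of the projective line.\<close>

lemma segre_line_cong:
  assumes "(a, b) \<noteq> (0, 0)" "(a', b') \<noteq> (0, 0)" "a * b' = a' * b"
  shows "segre_line a b = segre_line a' b'"
proof -
  have sub: "segre_line a' b' \<subseteq> segre_line a b"
    if nz: "(a, b) \<noteq> (0, 0)" and ab: "a * b' = a' * b" for a b a' b'
  proof -
    obtain r where r: "a' = r * a" "b' = r * b"
    proof (cases "a = 0")
      case True
      with nz ab that[of "b' / b"] show thesis by auto
    next
      case False
      with ab that[of "a' / a"] show thesis by (simp add: field_simps)
    qed
    have "segre a' b' c d = segre a b (r * c) (r * d)" for c d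
      by (simp add: segre_eq_iff r)
    then show ?thesis
      unfolding segre_line_def by blast
  qed
  from assms show ?thesis
    using sub[of a b b' a'] sub[of a' b' b a] by (metis subset_antisym)
qed

text \<open>Exchanging \<open>e2\<close> and \<open>f1\<close> transposes \<open>2 \<times> 2\<close> matrices and hence exchanges the two rulings.\<close>

lemma transposed: "segre_basis q e1 f1 e2 f2"
proof
  show "\<exists>x y z t. u = x *s e1 + y *s f1 + z *s e2 + t *s f2" for u
  proof -
    obtain x y z t where "u = x *s e1 + y *s e2 + z *s f1 + t *s f2"
      using span by blast
    then have "u = x *s e1 + z *s f1 + y *s e2 + t *s f2"
      by (simp add: add_ac)
    then show ?thesis by blast
  qed
  show "eval_mpoly q (x *s e1 + y *s f1 + z *s e2 + t *s f2) = x * t - y * z" for x y z t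
    using eval_q[of x z y t] by (simp add: algebra_simps)
qed

end

context segre_basis
begin

text \<open>Through \<open>T\<close> every fact on \<open>segre_line\<close> also holds for the
  other family, with the two pairs of parameters exchanged.\<close>

interpretation T: segre_basis q e1 f1 e2 f2
  by (rule transposed)

lemma T_segre: "T.segre c d a b = segre a b c d"
  by (simp add: T.segre_def segre_def algebra_simps)

lemma segre_linear': "segre (x * a + y * a') (x * b + y * b') c d = x *s segre a b c d + y *s segre a' b' c d"
  using T.segre_linear by (simp add: T_segre)

lemma segre_mem [intro]: "segre a b c d \<in> segre_line a b" "segre a b c d \<in> T.segre_line c d"
  by (auto simp: segre_line_def T.segre_line_def T_segre)

text \<open>For spanning vectors \<open>u\<close> and \<open>v\<close> of rank one,
  \<open>q(u + v)\<close> factors as \<open>(a b' - a' b)(c d' - c' d)\<close>. Its vanishing makes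
  one kind of pairs proportional, which puts \<open>u\<close> and \<open>v\<close> on a common line
  of one family.\<close>

lemma line_on_quadric:
  assumes L: "proj_line L" "lies_on L q"
  shows "(\<exists>a b. (a, b) \<noteq> (0, 0) \<and> L = segre_line a b) \<or> (\<exists>c d. (c, d) \<noteq> (0, 0) \<and> L = T.segre_line c d)"
proof -
  obtain u v where uv: "L = {x *s u + y *s v | x y. True}" "\<forall>x y. x *s u + y *s v = 0 \<longrightarrow> x = 0 \<and> y = 0"
    using proj_line_basis[OF L(1)] by blast
  have mem: "x *s u + y *s v \<in> L" for x y
    using uv(1) by blast
  have Q: "eval_mpoly q (x *s u + y *s v) = 0" for x y
    using L(2) mem by (auto simp: lies_on_def)
  obtain a b c d where u: "u = segre a b c d"
    using eval_q_eq_0_imp_segre[of u] Q[of 1 0] by auto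
  obtain a' b' c' d' where v: "v = segre a' b' c' d'"
    using eval_q_eq_0_imp_segre[of v] Q[of 0 1] by auto
  have nz: "(a, b) \<noteq> (0, 0)" "(c, d) \<noteq> (0, 0)" "(a', b') \<noteq> (0, 0)" "(c', d') \<noteq> (0, 0)"
    using uv(2)[rule_format, of 1 0] uv(2)[rule_format, of 0 1]
    by (auto simp: u v segre_eq_0_iff)
  have "u + v = (a * c + a' * c') *s e1 + (a * d + a' * d') *s e2 + (b * c + b' * c') *s f1 + (b * d + b' * d') *s f2"
    by (simp add: u v segre_def vec.scale_left_distrib)
  then have "(a * c + a' * c') * (b * d + b' * d') - (a * d + a' * d') * (b * c + b' * c') = 0"
    using Q[of 1 1] eval_q by simp
  then have "(a * b' - a' * b) * (c * d' - c' * d) = 0"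
    by (simp add: algebra_simps)
  then consider "a * b' = a' * b" | "c * d' = c' * d"
    by auto
  then show ?thesis
  proof cases
    case 1
    have "v \<in> segre_line a b"
      using segre_mem(1)[of a' b' c' d'] segre_line_cong[OF nz(1,3) 1] by (simp add: v)
    then obtain x y where "v = segre a b x y"
      by (auto simp: segre_line_def)
    then have "L \<subseteq> segre_line a b"
      unfolding uv(1) u by (auto simp flip: segre_linear)
    with proj_line_eq_segre_line[OF L(1)] nz(1) show ?thesis by blast
  next
    case 2
    have "v \<in> T.segre_line c d"
      using segre_mem(2)[of a' b' c' d'] T.segre_line_cong[OF nz(2,4) 2] by (simp add: v)
    then obtain x y where "v = segre x y c d"
      by (auto simp: T.segre_line_def T_segre)
    then have "L \<subseteq> T.segre_line c d"
      unfolding uv(1) u by (auto simp flip: segre_linear')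
    with T.proj_line_eq_segre_line[OF L(1)] nz(2) show ?thesis by blast
  qed
qed

text \<open>On \<open>segre_line a b\<close> the second pair is arbitrary, on
  \<open>T.segre_line c d\<close> it is fixed up to proportionality.\<close>

lemma segre_line_neq:
  assumes ab: "(a, b) \<noteq> (0, 0)" and cd: "(c, d) \<noteq> (0, 0)"
  shows "segre_line a b \<noteq> T.segre_line c d"
proof
  assume eq: "segre_line a b = T.segre_line c d"
  have *: "c * d' = c' * d" for c' d'
  proof -
    have "segre a b c' d' \<in> T.segre_line c d"
      using segre_mem(1) by (simp flip: eq)
    then obtain a' b' where "segre a b c' d' = segre a' b' c d"
      by (auto simp: T.segre_line_def T_segre)
    then have h: "a * c' = a' * c" "a * d' = a' * d" "b * c' = b' * c" "b * d' = b' * d"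
      by (simp_all add: segre_eq_iff)
    have "a * (c * d' - c' * d) = c * (a * d') - d * (a * c')" "b * (c * d' - c' * d) = c * (b * d') - d * (b * c')"
      by (simp_all add: algebra_simps)
    then have "a * (c * d' - c' * d) = 0" "b * (c * d' - c' * d) = 0"
      unfolding h by simp_all
    with ab show ?thesis by auto
  qed
  from *[of 0 1] *[of 1 0] cd show False by simp
qed

text \<open>Lines of different families meet in the nonzero vector \<open>segre a b c d\<close>,
  which lies on only one line of a ruling.\<close>

lemma ruling_one_type:
  assumes "smooth_quadric q" "ruling q F" "segre_line a b \<in> F" "(a, b) \<noteq> (0, 0)"
    "T.segre_line c d \<in> F" "(c, d) \<noteq> (0, 0)"
  shows False
  using ruling_unique[OF assms(1,2,3,5) segre_mem] assms segre_line_neq by (auto simp: segre_eq_0_iff)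

text \<open>\<open>G\<close> covers the point \<open>segre a b 1 0\<close> of each \<open>L\<close>
  in \<open>F\<close>, and the only line of the same family through it is \<open>L\<close>. Applied
  both ways, this identifies two rulings of one family.\<close>

lemma rulings_subset:
  assumes q: "smooth_quadric q" and F: "ruling q F" and G: "ruling q G"
    and F1: "\<And>L. L \<in> F \<Longrightarrow> \<exists>a b. (a, b) \<noteq> (0, 0) \<and> L = segre_line a b"
    and G1: "\<And>L. L \<in> G \<Longrightarrow> \<exists>a b. (a, b) \<noteq> (0, 0) \<and> L = segre_line a b"
  shows "F \<subseteq> G"
proof
  fix L assume "L \<in> F"
  then obtain a b where ab: "(a, b) \<noteq> (0, 0)" "L = segre_line a b"
    using F1[OF \<open>L \<in> F\<close>] by blast
  let ?u = "segre a b 1 0"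
  have "?u \<noteq> 0"
    using ab by (auto simp: segre_eq_0_iff)
  then have "proj_point (vec.span {?u})" "lies_on (vec.span {?u}) q"
    using q by (auto simp: smooth_quadric_def eval_segre intro!: proj_point_span lies_on_span)
  then obtain M where M: "M \<in> G" "vec.span {?u} \<subseteq> M"
    using G unfolding ruling_def by blast
  then obtain a' b' where ab': "(a', b') \<noteq> (0, 0)" "M = segre_line a' b'"
    using G1[OF M(1)] by blast
  have "?u \<in> M"
    using M(2) vec.span_base[of ?u "{?u}"] by blast
  then obtain c d where "?u = segre a' b' c d"
    by (auto simp: ab' segre_line_def)
  then have h: "a = a' * c" "b = b' * c"
    by (simp_all add: segre_eq_iff)
  have "a * b' = a' * b"
    by (simp add: h)
  then have "L = M"
    unfolding ab(2) ab'(2) by (rule segre_line_cong[OF ab(1) ab'(1)])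
  with M(1) show "L \<in> G" by simp
qed

text \<open>For fixed \<open>(c, d)\<close> the form of \<open>segre a b c d\<close> is linear in
  \<open>(a, b)\<close>, so its power is a binary form, and the lines of \<open>A\<close> supply
  more than \<open>n\<close> distinct points of the projective line.\<close>

lemma power_on_segre_lines:
  assumes J: "mpoly.subspace J" and n: "n < card A"
    and A: "\<And>L. L \<in> A \<Longrightarrow> \<exists>a b. (a, b) \<noteq> (0, 0) \<and> L = segre_line a b"
    and pow: "\<And>a b. (a, b) \<noteq> (0, 0) \<Longrightarrow> segre_line a b \<in> A \<Longrightarrow> linear_form (segre a b c d) ^ n \<in> J"
  shows "linear_form (segre a b c d) ^ n \<in> J"
proof -
  have "\<forall>L\<in>A. \<exists>p. p \<noteq> (0, 0) \<and> L = segre_line (fst p) (snd p)"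
    using A by fastforce
  then obtain p where p: "p L \<noteq> (0, 0)" "segre_line (fst (p L)) (snd (p L)) = L" if "L \<in> A" for L
    by metis
  define P where "P = linear_form (segre 1 0 c d)"
  define Q where "Q = linear_form (segre 0 1 c d)"
  have lin: "linear_form (segre a b c d) = const_mpoly a * P + const_mpoly b * Q" for a b
    using segre_linear'[of a 1 b 0 0 1 c d] by (simp add: linear_form_add linear_form_scale P_def Q_def)
  have "inj_on p A"
    using p by (metis inj_onI)
  then have "card (p ` A) = card A"
    by (rule card_image)
  show ?thesis
    unfolding lin
  proof (rule power_in_subspace[OF J, of n "p ` A"])
    show "n < card (p ` A)"
      using n \<open>card (p ` A) = card A\<close> by simp
    show "(0, 0) \<notin> p ` A"
      using p(1) by (metis imageE)
    show "(\<alpha>, \<beta>) = (\<alpha>', \<beta>')"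
      if h: "(\<alpha>, \<beta>) \<in> p ` A" "(\<alpha>', \<beta>') \<in> p ` A" "\<alpha> * \<beta>' = \<alpha>' * \<beta>" for \<alpha> \<beta> \<alpha>' \<beta>'
    proof -
      obtain L M where LM: "L \<in> A" "(\<alpha>, \<beta>) = p L" "M \<in> A" "(\<alpha>', \<beta>') = p M"
        using h(1,2) by auto
      have "segre_line \<alpha> \<beta> = segre_line \<alpha>' \<beta>'"
        using h(3) p(1)[OF LM(1)] p(1)[OF LM(3)] LM by (intro segre_line_cong) auto
      then have "L = M"
        using p(2)[OF LM(1)] p(2)[OF LM(3)] by (simp flip: LM(2,4))
      with LM show ?thesis by simp
    qed
    show "(const_mpoly \<alpha> * P + const_mpoly \<beta> * Q) ^ n \<in> J"
      if h: "(\<alpha>, \<beta>) \<in> p ` A" for \<alpha> \<beta>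
    proof -
      obtain L where L: "L \<in> A" "(\<alpha>, \<beta>) = p L"
        using h by blast
      then have "(\<alpha>, \<beta>) \<noteq> (0, 0)" "segre_line \<alpha> \<beta> \<in> A"
        using p[OF L(1)] by (auto simp flip: L(2))
      then show ?thesis
        unfolding lin[symmetric] by (rule pow)
    qed
  qed
qed

end

theorem corollary3p5:
  fixes q :: "('k::field_char_0, 4) mpoly"
    and Z :: "('k ^ 4) set set"
    and l :: "('k ^ 4) set \<Rightarrow> ('k, 4) mpoly"
    and a b d :: nat
  assumes "smooth_quadric q"
    and "a \<le> b"
    and "grid q a b Z"
    and "\<forall>P\<in>Z. dual_form P (l P)"
    and "1 \<le> d" and "d \<le> a - 1"
  shows "weak_lefschetz (Idl\<^bsub>mpoly_ring\<^esub> ((\<lambda>P. l P ^ d) ` Z))"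
proof -
  note q = assms(1)
  have q2: "q \<in> homogeneous_part 2"
    using q by (simp add: smooth_quadric_def)
  obtain F G A B where F: "ruling q F" "A \<subseteq> F" "card A = a" "finite A"
    and G: "ruling q G" "B \<subseteq> G" "card B = b" and "F \<noteq> G"
    and Z: "Z = {P. proj_point P \<and> (\<exists>L\<in>A. \<exists>M\<in>B. P \<subseteq> L \<and> P \<subseteq> M)}"
    using assms(3) by (auto simp: grid_def)

  \<comment> \<open>Segre coordinates and the families of the two rulings\<close>
  have line: "proj_line L" "lies_on L q" if "L \<in> F \<union> G" for L
    using that F(1) G(1) by (auto simp: ruling_def)
  \<comment> \<open>\<open>1 \<le> d \<le> a - 1\<close> forces \<open>a \<ge> 2\<close>, which
    supplies two skew lines for the basis.\<close>
  have "2 \<le> card A"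
    using F(3) assms(5,6) by simp
  then obtain L M where LM: "L \<in> A" "M \<in> A" "L \<noteq> M"
    by (meson card_2_iff' ex_card subset_iff)
  have "L \<inter> M = {0}"
    using ruling_unique[OF q F(1), of L M] LM F(2) line[of L] line[of M]
    by (auto simp: proj_line_def vec.subspace_0)
  then obtain e1 e2 f1 f2 where e: "e1 \<in> L" "e2 \<in> L"
      "\<And>u. \<exists>x y z t. u = x *s e1 + y *s e2 + z *s f1 + t *s f2"
      "\<And>x y z t. eval_mpoly q (x *s e1 + y *s e2 + z *s f1 + t *s f2) = x * t - y * z"
    using LM F(2) line[of L] line[of M]
    by (elim segre_basis_exists[OF q, of L M, rotated -1]) auto
  interpret S: segre_basis q e1 e2 f1 f2
    by unfold_locales (use e in auto)
  interpret T: segre_basis q e1 f1 e2 f2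
    by (rule S.transposed)
  have types: "(\<exists>a b. (a, b) \<noteq> (0, 0) \<and> L = S.segre_line a b) \<or> (\<exists>c d. (c, d) \<noteq> (0, 0) \<and> L = T.segre_line c d)"
    if "L \<in> F \<union> G" for L
    using S.line_on_quadric line[OF that] .
  have mem_L: "S.segre 1 0 x y \<in> L" for x y
    using e(1,2) line[of L] LM(1) F(2)
    by (auto simp: S.segre_def proj_line_def intro!: vec.subspace_add vec.subspace_scale)
  \<comment> \<open>\<open>L\<close> contains \<open>e1 = segre 1 0 1 0\<close> and
    \<open>e2 = segre 1 0 0 1\<close>, whose second pairs are not proportional. This decides the
    family of \<open>L\<close>, and with it that of all of \<open>F\<close>.\<close>
  have "L \<noteq> T.segre_line z t" for z t
  proof
    assume "L = T.segre_line z t"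
    then obtain x y x' y' where "S.segre 1 0 1 0 = S.segre x y z t" "S.segre 1 0 0 1 = S.segre x' y' z t"
      using mem_L[of 1 0] mem_L[of 0 1] by (auto simp: T.segre_line_def S.T_segre)
    then have "x * z = 1" "x * t = 0" "x' * t = 1"
      by (auto simp: S.segre_eq_iff)
    then show False by auto
  qed
  then obtain x0 y0 where L: "(x0, y0) \<noteq> (0, 0)" "L = S.segre_line x0 y0"
    using types[of L] LM(1) F(2) by blast
  have F_type: "\<exists>x y. (x, y) \<noteq> (0, 0) \<and> N = S.segre_line x y" if "N \<in> F" for N
    using types[of N] that S.ruling_one_type[OF q F(1), of x0 y0] LM(1) F(2) L by blast
  \<comment> \<open>One line of the first family in \<open>G\<close> would make all of
    \<open>G\<close> of that family, and then \<open>F = G\<close>.\<close>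
  have G_type: "\<exists>z t. (z, t) \<noteq> (0, 0) \<and> N = T.segre_line z t" if "N \<in> G" for N
  proof (rule ccontr)
    assume "\<nexists>z t. (z, t) \<noteq> (0, 0) \<and> N = T.segre_line z t"
    with types[OF UnI2[OF that]] have "\<exists>x y. (x, y) \<noteq> (0, 0) \<and> N = S.segre_line x y"
      by (elim disjE) (assumption | erule notE, assumption)+
    then obtain x y where N: "(x, y) \<noteq> (0, 0)" "N = S.segre_line x y"
      by blast
    have "\<exists>x y. (x, y) \<noteq> (0, 0) \<and> N' = S.segre_line x y" if "N' \<in> G" for N'
      using types[of N'] that S.ruling_one_type[OF q G(1), of x y] \<open>N \<in> G\<close> N by blast
    then have "F = G"
      using S.rulings_subset[OF q F(1) G(1)] S.rulings_subset[OF q G(1) F(1)] F_type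
      by (metis subset_antisym)
    with \<open>F \<noteq> G\<close> show False ..
  qed

  \<comment> \<open>Powers of the forms of all points of the quadric\<close>
  define I where "I = Idl\<^bsub>mpoly_ring\<^esub> ((\<lambda>P. l P ^ d) ` Z)"
  interpret R: cring "mpoly_ring :: ('k, 4) mpoly ring"
    by (rule cring_from_type_algebra)
  have carr: "carrier (mpoly_ring :: ('k, 4) mpoly ring) = UNIV"
    by (simp add: ring_of_type_algebra_def)
  have I: "ideal I mpoly_ring"
    unfolding I_def by (rule R.genideal_ideal) (simp add: carr)
  note SI = ideal_imp_subspace[OF I]
  \<comment> \<open>The dual form of a grid point is known only up to a nonzero scalar
    \<open>c\<close>, whose power \<open>c ^ d\<close> is divided out.\<close>
  have pow_grid: "linear_form (S.segre x y z t) ^ d \<in> I"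
    if xy: "(x, y) \<noteq> (0, 0)" "S.segre_line x y \<in> A" and zt: "(z, t) \<noteq> (0, 0)" "T.segre_line z t \<in> B"
    for x y z t
  proof -
    let ?u = "S.segre x y z t"
    let ?P = "vec.span {?u}"
    have "vec.subspace (S.segre_line x y)" "vec.subspace (T.segre_line z t)"
      using line(1) xy(2) zt(2) F(2) G(2) by (auto simp: proj_line_def)
    then have "?P \<subseteq> S.segre_line x y" "?P \<subseteq> T.segre_line z t"
      by (simp_all add: vec.span_minimal S.segre_mem)
    moreover have "?u \<noteq> 0"
      using xy(1) zt(1) by (auto simp: S.segre_eq_0_iff)
    ultimately have "?P \<in> Z"
      using xy(2) zt(2) proj_point_span by (auto simp: Z)
    then obtain v where v: "v \<in> ?P" "v \<noteq> 0" "l ?P = linear_form v"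
      using assms(4) unfolding dual_form_def by blast
    then obtain c where "v = c *s ?u"
      by (auto simp: vec.span_singleton)
    with v have c: "c *s ?u \<noteq> 0" "l ?P = linear_form (c *s ?u)"
      by simp_all
    have "const_mpoly (c ^ d) * linear_form ?u ^ d = l ?P ^ d"
      by (simp add: c(2) linear_form_scale power_mult_distrib const_mpoly_power)
    also have "\<dots> \<in> I"
      using \<open>?P \<in> Z\<close> R.genideal_self[of "(\<lambda>P. l P ^ d) ` Z"] by (auto simp: I_def carr)
    finally have "const_mpoly (inverse (c ^ d)) * (const_mpoly (c ^ d) * linear_form ?u ^ d) \<in> I"
      by (rule mpoly.subspace_scale[OF SI])
    with c(1) show ?thesis
      by (simp add: mult_single flip: mult.assoc)
  qed
  \<comment> \<open>Interpolation over the \<open>a > d\<close> lines of \<open>A\<close> frees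
    \<open>(x, y)\<close>; the next one, over the \<open>b \<ge> a\<close> lines of
    \<open>B\<close>, frees \<open>(z, t)\<close>.\<close>
  have pow_line: "linear_form (S.segre x y z t) ^ d \<in> I" if "(z, t) \<noteq> (0, 0)" "T.segre_line z t \<in> B" for x y z t
    by (rule S.power_on_segre_lines[OF SI, of d A])
      (use F(2,3) F_type assms(5,6) pow_grid that in auto)
  have "linear_form (T.segre z t x y) ^ d \<in> I" for x y z t
  proof (rule T.power_on_segre_lines[OF SI])
    show "d < card B"
      using G(3) assms(2,5,6) by simp
  qed (use G(2) G_type pow_line in \<open>auto simp: S.T_segre\<close>)
  then have pow: "linear_form (S.segre x y z t) ^ d \<in> I" for x y z t
    by (simp add: S.T_segre)

  \<comment> \<open>The open set of linear forms and the criterion\<close>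
  define w where "w = (\<chi> i. polar q e1 (axis i 1))"
  have w: "eval_mpoly (linear_form w) u = polar q e1 u" for u
    by (subst polar_eq_sum[OF q2]) (simp add: eval_mpoly_linear_form w_def)
  have polar_e1: "polar q e1 (x *s e1 + y *s e2 + z *s f1 + t *s f2) = t" for x y z t
  proof -
    have sum: "e1 + (x *s e1 + y *s e2 + z *s f1 + t *s f2) = (1 + x) *s e1 + y *s e2 + z *s f1 + t *s f2"
      by (simp add: vec.scale_left_distrib add.assoc)
    show ?thesis
      unfolding polar_def sum S.eval_q using S.eval_q[of 1 0 0 0] by (simp add: algebra_simps)
  qed
  \<comment> \<open>\<open>U\<close> is the complement of the tangent space at \<open>e1\<close>,
    that is, of the vanishing of the coordinate along \<open>f2\<close>; this is the condition
    \<open>v22 \<noteq> 0\<close> of \<open>prod_linear_forms_mem\<close>.\<close>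
  define U where "U = {v. polar q e1 v \<noteq> 0}"
  have "l P ^ d \<in> homogeneous_part d" if "P \<in> Z" for P
  proof -
    have "dual_form P (l P)"
      using assms(4) that by blast
    then obtain v where "l P = linear_form v"
      by (auto simp: dual_form_def)
    then show ?thesis
      using power_in_homogeneous_part[OF linear_form_in_homogeneous_part[of v], of d] by simp
  qed
  then have hom: "(\<lambda>P. l P ^ d) ` Z \<subseteq> homogeneous_part d"
    by blast
  \<comment> \<open>The basis vectors lie on the quadric, so a variable is a sum of four forms with
    \<open>d\<close>-th power in \<open>I\<close>, and its power with exponent \<open>4d\<close> is
    in \<open>I\<close>.\<close>
  have nil: "\<exists>n. Poly_Mapping.single (Poly_Mapping.single i 1) 1 ^ n \<in> I" for i :: 4
  proof -
    obtain x y z t where "axis i 1 = x *s e1 + y *s e2 + z *s f1 + t *s f2"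
      using S.span by blast
    then have "linear_form (axis i 1) = linear_form (S.segre x 0 1 0) + linear_form (S.segre y 0 0 1)
        + linear_form (S.segre 0 z 1 0) + linear_form (S.segre 0 t 0 1)"
      by (simp add: S.segre_def linear_form_add)
    then show ?thesis
      using power_add_in_ideal[OF I power_add_in_ideal[OF I power_add_in_ideal[OF I pow pow] pow] pow]
      unfolding linear_form_axis by metis
  qed
  have U: "zariski_open U"
    unfolding zariski_open_def U_def by (rule exI[of _ "{linear_form w}"]) (simp add: w)
  have U_ne: "U \<noteq> {}" "0 \<notin> U"
    using polar_e1[of 0 0 0 1] polar_e1[of 0 0 0 0] by (auto simp: U_def intro: exI[of _ f2])
  have gen: "\<exists>h\<in>homogeneous_part (d - 1). prod_list us - linear_form v * h \<in> I"
    if v: "v \<in> U" and us: "length us = d" "set us \<subseteq> range linear_form" for v us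
  proof -
    obtain x y z t where xyzt: "v = x *s e1 + y *s e2 + z *s f1 + t *s f2"
      using S.span by blast
    with v have "t \<noteq> 0"
      using polar_e1 by (simp add: U_def)
    \<comment> \<open>The chart of \<open>prod_linear_forms_mem\<close> is
      \<open>segre 1 b 1 c\<close>.\<close>
    moreover have "linear_form (e1 + c *s e2 + b *s f1 + (b * c) *s f2) ^ d \<in> I" for b c
      using pow[of 1 b 1 c] by (simp add: S.segre_def)
    ultimately show ?thesis
      by (intro prod_linear_forms_mem[OF I S.span _ xyzt _ us]) auto
  qed
  show ?thesis
    by (rule weak_lefschetzI[OF hom assms(5) nil[unfolded I_def] U U_ne gen[unfolded I_def]])
qed

end
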